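(* Let $A \in H_\theta(\Omega)$, let $A^\star \in H_\theta(\Omega^\star)$ be a dual potential of $A$, and let $W \in H_\theta(X)$ be an involution kernel between $A$ and $A^\star$. Let \[ \rho = \lim_{n \to \infty} \sup_{x' \in \Omega} \left( \int dx_1 \cdots \int dx_n \, e^{\Re A^n(x_1 \ldots x_n x')} \right)^{1/n}. \] Let $\lambda \in \mathbb{C}$ with $|\lambda| > \rho\theta$. Then the map \[ \Phi_W : \mathcal{D} \in H_\theta(\Omega^\star)' \mapsto \left( x \in \Omega \mapsto \langle \mathcal{D}, e^{W(\cdot | x)} \rangle \right) \in \mathcal{C}(\Omega) \] is a continuous linear operator that induces an isomorphism from the space of eigendistributions of $\mathcal{L}_{A^\star}$ for the eigenvalue $\lambda$ onto the space of eigenfunctions of $\mathcal{L}_A$ for the same eigenvalue $\lambda$. Moreover, the inverse is given explicitly as a limit of a sequence of measures: if $\psi \in H_\theta(\Omega)$ is a $\lambda$-eigenfunction of $\mathcal{L}_A$, then for any choice of $x' \in \Omega$ and of a symbol $0 \in M$ (with $0^\infty = (\ldots 0 0) \in \Omega^\star$), the functional $\mathcal{D}$ given by \[ \forall \varphi \in H_\theta(\Omega^\star), \quad \langle \mathcal{D}, \varphi \rangle = \lim_{n \to \infty} \int dx_1 \cdots \int dx_n \, \psi(x_n \ldots x_1 x') \, \frac{e^{A^n(x_n \ldots x_1 x')}}{\lambda^n} \, e^{-W(0^\infty x_n \ldots x_1 | x')} \, \varphi(0^\infty x_n \ldots x_1) \] is an element of $H_\theta(\Omega^\star)'$, does not depend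 on $x'$, is a $\lambda$-eigendistribution of $\mathcal{L}_{A^\star}$, and satisfies $\Phi_W(\mathcal{D}) = \psi$.
   Context: Let $0<\theta<1$ and $M = \{1, \ldots, d\}$. $\Omega = M^{\mathbb{N}}$ is the space of sequences $x = (x_1 x_2 \ldots)$ with shift $\sigma(x_1 x_2 \ldots) = (x_2 x_3 \ldots)$. $\Omega^\star = M^{\mathbb{N}}$ is a second copy, with points written backwards $y = (\ldots y_2 y_1)$ and shift $\sigma^\star(\ldots y_2 y_1) = (\ldots y_3 y_2)$. Both carry the usual (product) compact metrizable topology. $X = \Omega^\star \times \Omega$ has points $(y|x)$ and shift $\hat\sigma(\ldots y_2 y_1 | x_1 x_2 \ldots) = (\ldots y_2 y_1 x_1 | x_2 x_3 \ldots)$, so $\hat\sigma^{-1}(y|x) = (\sigma^\star(y) | \tau_y(x))$ with $\tau_y(x) = (y_1 x)$. Juxtaposition denotes concatenation of symbols. Write $x \sim_n x'$ if the symbols of $x, x'$ agree up to coordinate $n$ (no condition if $n=0$); similarly on $\Omega^\star$. A map $f : \Omega \to \mathbb{C}$ is $\theta$-Hölder if there is $C \ge 0$ with $|f(x)-f(x')| \le C\theta^n$ whenever $n \ge 0$ and $x \sim_n x'$; its seminorm is $\|f\|_\theta = \sup_{n \ge 1} \sup_{x \sim_n x'} |f(x)-f(x')|/\theta^n$; similarly on $\Omega^\star$. A map $g : X \to \mathbb{C}$ is $\theta$-Hölder if there is $C \ge 0$ such that $|g(y|x) - g(y'|x')| \le C\theta^n$ whenever $n \ge 0$, $x \sim_n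 x'$ and $y \sim_n y'$, and $\|g\|_\theta$ is the smallest such $C$. $H_\theta(\Omega), H_\theta(\Omega^\star), H_\theta(X)$ are the spaces of complex-valued $\theta$-Hölder functions with norm $\|\cdot\|_\infty + \|\cdot\|_\theta$. $H_\theta(\Omega^\star)'$ is the space of continuous linear functionals on $H_\theta(\Omega^\star)$, with the operator norm, and $\langle \mathcal{D},\varphi\rangle$ denotes evaluation. $\mathcal{C}(\Omega)$ is the space of continuous maps $\Omega\to\mathbb{C}$ with the supremum norm. Dual potential and involution kernel: $A^\star : \Omega^\star \to \mathbb{C}$ is a dual potential of $A$, and $W : X \to \mathbb{C}$ is an involution kernel between $A$ and $A^\star$, when for all $(y|x) \in X$, $A^\star(y) = A(\tau_y(x)) + W(\hat\sigma^{-1}(y|x)) - W(y|x)$. A probability measure $\sum_{j=1}^d a_j \delta_j$ on $M$ is fixed, and $\int f(a)\,da = \sum_j a_j f(j)$ denotes integration against it. Ruelle operators: $\mathcal{L}_A\varphi(x) = \int_M e^{A(ax)}\varphi(ax)\,da$ on $H_\theta(\Omega)$ and $\mathcal{L}_{A^\star}\varphi(y) = \int_M e^{A^\star(ya)}\varphi(ya)\,da$ on $H_\theta(\Omega^\star)$. Birkhoff sums: $A^n(x) = \sum_{k=0}^{n-1} A(\sigma^k(x))$. The $\lambda$-eigenfunctions of $\mathcal{L}_A$ are the $\psi \in H_\theta(\Omega)$ with $\mathcal{L}_A\psi = \lambda\psi$. The $\lambda$-eigendistributions of $\mathcal{L}_{A^\star}$ are the $\mathcal{D} \in H_\theta(\Omega^\star)'$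 with $\langle\mathcal{D}, \mathcal{L}_{A^\star}\varphi\rangle = \lambda\langle\mathcal{D},\varphi\rangle$ for all $\varphi \in H_\theta(\Omega^\star)$. (Zero is included, so these are vector spaces.) *)

theory Defs
  imports "HOL-Analysis.Analysis" "HOL-Library.Stream"
begin

text \<open>
  The alphabet \<open>M\<close> is a finite type \<open>'m\<close>. Both \<open>\<Omega>\<close> and \<open>\<Omega>\<^sup>\<star>\<close> are the type \<open>'m stream\<close>:
  \<open>x !! i\<close> is the symbol \<open>x\<^sub>i\<^sub>+\<^sub>1\<close> of \<open>(x\<^sub>1 x\<^sub>2 \<dots>)\<close>, and \<open>y !! i\<close> is the symbol \<open>y\<^sub>i\<^sub>+\<^sub>1\<close> of the
  backwards point \<open>(\<dots> y\<^sub>2 y\<^sub>1)\<close>. Thus both shifts are \<^const>\<open>stl\<close>; the points \<open>ax\<close> of \<open>\<Omega>\<close> and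
  \<open>ya\<close> of \<open>\<Omega>\<^sup>\<star>\<close> are \<open>a ## x\<close> and \<open>a ## y\<close>; and \<open>x \<sim>\<^sub>n x'\<close> is \<open>stake n x = stake n x'\<close>.
  A point \<open>(y|x)\<close> of \<open>X\<close> is the pair \<open>(y, x)\<close>.
\<close>

definition seq_topology :: "'m stream topology" where
  "seq_topology =
     pullback_topology UNIV snth (product_topology (\<lambda>_. discrete_topology UNIV) UNIV)"

definition sup_norm :: "('a \<Rightarrow> complex) \<Rightarrow> real" where
  "sup_norm f = (SUP x. cmod (f x))"

definition Cont :: "('m stream \<Rightarrow> complex) set" where
  "Cont = {f. continuous_map seq_topology euclidean f}"


definition Holder :: "real \<Rightarrow> ('m stream \<Rightarrow> complex) set" where
  "Holder \<theta> = {f. \<exists>C\<ge>0. \<forall>n x x'. stake n x = stake n x' \<longrightarrow> cmod (f x - f x') \<le> C * \<theta> ^ n}"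

definition holder_seminorm :: "real \<Rightarrow> ('m stream \<Rightarrow> complex) \<Rightarrow> real" where
  "holder_seminorm \<theta> f =
     (SUP (n, x, x') \<in> {(n, x, x'). n \<ge> 1 \<and> stake n x = stake n x'}. cmod (f x - f x') / \<theta> ^ n)"

definition holder_norm :: "real \<Rightarrow> ('m stream \<Rightarrow> complex) \<Rightarrow> real" where
  "holder_norm \<theta> f = sup_norm f + holder_seminorm \<theta> f"

definition Holder_X :: "real \<Rightarrow> ('m stream \<times> 'm stream \<Rightarrow> complex) set" where
  "Holder_X \<theta> = {g. \<exists>C\<ge>0. \<forall>n x x' y y'. stake n x = stake n x' \<longrightarrow> stake n y = stake n y' \<longrightarrow>
     cmod (g (y, x) - g (y', x')) \<le> C * \<theta> ^ n}"


definition linear_on_funs :: "('a \<Rightarrow> complex) set \<Rightarrow> (('a \<Rightarrow> complex) \<Rightarrow> ('b \<Rightarrow> complex)) \<Rightarrow> bool" where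
  "linear_on_funs V T \<longleftrightarrow>
     (\<forall>f\<in>V. \<forall>g\<in>V. T (\<lambda>t. f t + g t) = (\<lambda>t. T f t + T g t)) \<and>
     (\<forall>c. \<forall>f\<in>V. T (\<lambda>t. c * f t) = (\<lambda>t. c * T f t))"

definition bounded_linear_on_funs ::
  "('a \<Rightarrow> complex) set \<Rightarrow> (('a \<Rightarrow> complex) \<Rightarrow> real) \<Rightarrow>
   ('b \<Rightarrow> complex) set \<Rightarrow> (('b \<Rightarrow> complex) \<Rightarrow> real) \<Rightarrow>
   (('a \<Rightarrow> complex) \<Rightarrow> ('b \<Rightarrow> complex)) \<Rightarrow> bool" where
  "bounded_linear_on_funs V nV U nU T \<longleftrightarrow>
     T ` V \<subseteq> U \<and> linear_on_funs V T \<and> (\<exists>C. \<forall>f\<in>V. nU (T f) \<le> C * nV f)"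

definition linear_iso_on_funs ::
  "('a \<Rightarrow> complex) set \<Rightarrow> ('b \<Rightarrow> complex) set \<Rightarrow> (('a \<Rightarrow> complex) \<Rightarrow> ('b \<Rightarrow> complex)) \<Rightarrow> bool" where
  "linear_iso_on_funs V U T \<longleftrightarrow> linear_on_funs V T \<and> bij_betw T V U"


text \<open>
  Functionals on \<open>H\<^sub>\<theta>\<close> are total HOL functions set to \<open>0\<close> outside \<open>H\<^sub>\<theta>\<close>, so that equality of
  members of \<open>Holder_dual\<close> is equality of functionals on \<open>H\<^sub>\<theta>\<close>.
\<close>

definition Holder_dual :: "real \<Rightarrow> (('m stream \<Rightarrow> complex) \<Rightarrow> complex) set" where
  "Holder_dual \<theta> = {D.
     (\<forall>\<phi>. \<phi> \<notin> Holder \<theta> \<longrightarrow> D \<phi> = 0) \<and>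
     (\<forall>\<phi>\<in>Holder \<theta>. \<forall>\<phi>'\<in>Holder \<theta>. D (\<lambda>y. \<phi> y + \<phi>' y) = D \<phi> + D \<phi>') \<and>
     (\<forall>c. \<forall>\<phi>\<in>Holder \<theta>. D (\<lambda>y. c * \<phi> y) = c * D \<phi>) \<and>
     (\<exists>C. \<forall>\<phi>\<in>Holder \<theta>. cmod (D \<phi>) \<le> C * holder_norm \<theta> \<phi>)}"

text \<open>As in \<^const>\<open>onorm\<close>, the quotient at \<open>\<phi> = 0\<close> is \<open>0 / 0 = 0\<close>.\<close>

definition dual_norm :: "real \<Rightarrow> (('m stream \<Rightarrow> complex) \<Rightarrow> complex) \<Rightarrow> real" where
  "dual_norm \<theta> D = (SUP \<phi>\<in>Holder \<theta>. cmod (D \<phi>) / holder_norm \<theta> \<phi>)"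


definition integ :: "('m::finite \<Rightarrow> real) \<Rightarrow> ('m \<Rightarrow> 'b::real_vector) \<Rightarrow> 'b" where
  "integ a f = (\<Sum>j\<in>UNIV. a j *\<^sub>R f j)"

text \<open>\<open>iter_integ a n F\<close> is \<open>\<integral>dx\<^sub>1 \<dots> \<integral>dx\<^sub>n F [x\<^sub>1, \<dots>, x\<^sub>n]\<close>.\<close>

primrec iter_integ :: "('m::finite \<Rightarrow> real) \<Rightarrow> nat \<Rightarrow> ('m list \<Rightarrow> 'b::real_vector) \<Rightarrow> 'b" where
  "iter_integ a 0 F = F []"
| "iter_integ a (Suc n) F = integ a (\<lambda>j. iter_integ a n (\<lambda>w. F (j # w)))"

text \<open>Under the encoding above, this one definition serves for both \<open>A\<close> and \<open>A\<^sup>\<star>\<close>.\<close>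

definition ruelle ::
  "('m::finite \<Rightarrow> real) \<Rightarrow> ('m stream \<Rightarrow> complex) \<Rightarrow> ('m stream \<Rightarrow> complex) \<Rightarrow> 'm stream \<Rightarrow> complex" where
  "ruelle a A \<phi> x = integ a (\<lambda>j. exp (A (j ## x)) * \<phi> (j ## x))"

definition birkhoff_sum :: "('m stream \<Rightarrow> complex) \<Rightarrow> nat \<Rightarrow> 'm stream \<Rightarrow> complex" where
  "birkhoff_sum A n x = (\<Sum>k<n. A (sdrop k x))"

definition eigenfunctions ::
  "real \<Rightarrow> ('m::finite \<Rightarrow> real) \<Rightarrow> ('m stream \<Rightarrow> complex) \<Rightarrow> complex \<Rightarrow> ('m stream \<Rightarrow> complex) set" where
  "eigenfunctions \<theta> a A l = {\<psi> \<in> Holder \<theta>. ruelle a A \<psi> = (\<lambda>x. l * \<psi> x)}"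

definition eigendistributions ::
  "real \<Rightarrow> ('m::finite \<Rightarrow> real) \<Rightarrow> ('m stream \<Rightarrow> complex) \<Rightarrow> complex \<Rightarrow>
   (('m stream \<Rightarrow> complex) \<Rightarrow> complex) set" where
  "eigendistributions \<theta> a Astar l =
     {D \<in> Holder_dual \<theta>. \<forall>\<phi>\<in>Holder \<theta>. D (ruelle a Astar \<phi>) = l * D \<phi>}"

text \<open>\<open>(stl y, shd y ## x)\<close> is the inverse shift of \<open>(y|x)\<close>.\<close>

definition involution_kernel ::
  "('m stream \<Rightarrow> complex) \<Rightarrow> ('m stream \<Rightarrow> complex) \<Rightarrow> ('m stream \<times> 'm stream \<Rightarrow> complex) \<Rightarrow> bool" where
  "involution_kernel A Astar W \<longleftrightarrow>
     (\<forall>y x. Astar y = A (shd y ## x) + W (stl y, shd y ## x) - W (y, x))"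


definition rho_seq :: "('m::finite \<Rightarrow> real) \<Rightarrow> ('m stream \<Rightarrow> complex) \<Rightarrow> nat \<Rightarrow> real" where
  "rho_seq a A n = root n (SUP x'. iter_integ a n (\<lambda>w. exp (Re (birkhoff_sum A n (w @- x')))))"

definition rho :: "('m::finite \<Rightarrow> real) \<Rightarrow> ('m stream \<Rightarrow> complex) \<Rightarrow> real" where
  "rho a A = lim (rho_seq a A)"

definition kernel_map ::
  "('m stream \<times> 'm stream \<Rightarrow> complex) \<Rightarrow> (('m stream \<Rightarrow> complex) \<Rightarrow> complex) \<Rightarrow> 'm stream \<Rightarrow> complex" where
  "kernel_map W D x = D (\<lambda>y. exp (W (y, x)))"

text \<open>
  With \<open>w = [x\<^sub>1, \<dots>, x\<^sub>n]\<close>, the point \<open>x\<^sub>n \<dots> x\<^sub>1 x'\<close> of \<open>\<Omega>\<close> is \<open>rev w @- x'\<close>, whereas the point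
  \<open>z\<^sup>\<infinity> x\<^sub>n \<dots> x\<^sub>1\<close> of \<open>\<Omega>\<^sup>\<star>\<close>, read from the right, is \<open>w @- sconst z\<close>.
\<close>

definition inverse_seq ::
  "('m::finite \<Rightarrow> real) \<Rightarrow> ('m stream \<Rightarrow> complex) \<Rightarrow> ('m stream \<times> 'm stream \<Rightarrow> complex) \<Rightarrow> complex \<Rightarrow>
   ('m stream \<Rightarrow> complex) \<Rightarrow> 'm stream \<Rightarrow> 'm \<Rightarrow> ('m stream \<Rightarrow> complex) \<Rightarrow> nat \<Rightarrow> complex" where
  "inverse_seq a A W l \<psi> x' z \<phi> n =
     iter_integ a n (\<lambda>w. \<psi> (rev w @- x') * (exp (birkhoff_sum A n (rev w @- x')) / l ^ n)
       * exp (- W (w @- sconst z, x')) * \<phi> (w @- sconst z))"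

definition inverse_functional ::
  "real \<Rightarrow> ('m::finite \<Rightarrow> real) \<Rightarrow> ('m stream \<Rightarrow> complex) \<Rightarrow> ('m stream \<times> 'm stream \<Rightarrow> complex) \<Rightarrow> complex \<Rightarrow>
   ('m stream \<Rightarrow> complex) \<Rightarrow> 'm stream \<Rightarrow> 'm \<Rightarrow> ('m stream \<Rightarrow> complex) \<Rightarrow> complex" where
  "inverse_functional \<theta> a A W l \<psi> x' z \<phi> =
     (if \<phi> \<in> Holder \<theta> then lim (inverse_seq a A W l \<psi> x' z \<phi>) else 0)"

end

theory Submission
  imports Defs
begin

text \<open>
  The kernel identity says that the two Ruelle operators agree on \<open>exp W\<close>, one acting in the variable
  \<open>y\<close> and the other in \<open>x\<close> (\<open>ruelle_exp_kernel\<close>). Hence pairing \<open>exp (W (\<cdot>, x))\<close> with an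
  eigendistribution of \<open>Astar\<close> gives a solution of the eigenvalue equation for \<open>A\<close>. That this solution is
  Hoelder is not a consequence of the regularity of \<open>W\<close> alone. It follows from the kernel identity
  again: moving the common prefix of two points \<open>y\<close> and \<open>y'\<close> to the other side shows that
  \<open>x \<mapsto> W (\<cdot>, x)\<close> is Hoelder as a map into the Hoelder functions (\<open>kernel_section_lipschitz\<close>).

  For the inverse, iterate the identity: the weight of a word \<open>w\<close> in the \<open>n\<close>-th iterate for \<open>Astar\<close> is the
  weight of the reversed word for \<open>A\<close>, up to a quotient of two values of \<open>exp W\<close>
  (\<open>birkhoff_sum_cocycle\<close>, \<open>dual_weight_eq\<close>). In \<open>D \<phi> = D ((ruelle a Astar ^^ n) \<phi>) / l ^ n\<close> the test
  function is evaluated at points with a long prefix \<open>w\<close>, so it may be frozen at \<open>w @- sconst z\<close>; what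
  remains under \<open>D\<close> is \<open>exp W\<close>, and \<open>D\<close> turns it into the eigenfunction. This expresses \<open>D\<close> through
  its image and proves injectivity (\<open>eigendistribution_eq_limit\<close>).

  Conversely, starting from an eigenfunction, the same measures form a sequence whose increments,
  whose dependence on the base point and whose defect in the eigenvalue equation are all integrals
  over words of length \<open>n\<close> of oscillations of Hoelder functions over points sharing about \<open>n\<close> symbols.
  Every such error is at most a constant times \<open>S n * \<theta> ^ n / \<bar>l\<bar> ^ n\<close>, where \<open>S n\<close> is the supremum of the
  integrated Birkhoff weights. Since \<open>S\<close> is submultiplicative, its \<open>n\<close>-th roots converge to \<open>rho\<close> by
  Fekete's lemma, and \<open>\<bar>l\<bar> > rho * \<theta>\<close> makes these errors summable (\<open>summable_decay\<close>).
\<close>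

section \<open>Hoelder functions\<close>

lemma stake_shift_eq_iff:
  "stake (length w + n) (w @- x) = stake (length w + n) (w @- x') \<longleftrightarrow> stake n x = stake n x'"
  by (simp add: stake_shift)

text \<open>
  A single constant controls the supremum and all oscillations, including those at \<open>n = 0\<close>.
  Up to a factor \<open>2\<close> in either direction it is the Hoelder norm (\<open>holder_norm_le\<close> and
  \<open>holder_bound_holder_norm\<close>), but it can be carried through products, exponentials and
  prepended words without handling a supremum.
\<close>

definition holder_bound :: "real \<Rightarrow> real \<Rightarrow> ('m stream \<Rightarrow> complex) \<Rightarrow> bool" where
  "holder_bound \<theta> K f \<longleftrightarrow>
     (\<forall>x. cmod (f x) \<le> K) \<and> (\<forall>n x x'. stake n x = stake n x' \<longrightarrow> cmod (f x - f x') \<le> K * \<theta> ^ n)"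

lemma holder_boundI:
  "\<lbrakk>\<And>x. cmod (f x) \<le> K; \<And>n x x'. stake n x = stake n x' \<Longrightarrow> cmod (f x - f x') \<le> K * \<theta> ^ n\<rbrakk>
    \<Longrightarrow> holder_bound \<theta> K f"
  by (auto simp: holder_bound_def)

lemma holder_bound_norm: "holder_bound \<theta> K f \<Longrightarrow> cmod (f x) \<le> K"
  by (auto simp: holder_bound_def)

lemma holder_bound_diff:
  "holder_bound \<theta> K f \<Longrightarrow> stake n x = stake n x' \<Longrightarrow> cmod (f x - f x') \<le> K * \<theta> ^ n"
  by (auto simp: holder_bound_def)

lemma holder_bound_nonneg: "holder_bound \<theta> K f \<Longrightarrow> 0 \<le> K"
  using holder_bound_norm norm_ge_zero order_trans by blast

lemma cmod_exp_diff_le: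
  assumes "cmod u \<le> K" "cmod v \<le> K"
  shows "cmod (exp u - exp v) \<le> exp K * cmod (u - v)"
proof (rule field_differentiable_bound[where S = "cball 0 K" and f' = exp])
  fix z :: complex assume "z \<in> cball 0 K"
  then have "exp (cmod z) \<le> exp K" by simp
  with norm_exp[of z] show "cmod (exp z) \<le> exp K" by (rule order_trans)
qed (use assms in \<open>auto intro!: derivative_eq_intros\<close>)

locale holder_exponent =
  fixes \<theta> :: real
  assumes theta_pos: "0 < \<theta>" and theta_less_1: "\<theta> < 1"
begin

lemma theta_pow: "0 < \<theta> ^ n" "\<theta> ^ n \<le> 1"
  using theta_pos theta_less_1 by (auto simp: power_le_one)

lemma holder_bound_mono:
  assumes "holder_bound \<theta> K f" "K \<le> L"
  shows "holder_bound \<theta> L f"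
proof (rule holder_boundI)
  show "cmod (f x) \<le> L" for x
    using holder_bound_norm[OF assms(1), of x] assms(2) by simp
  fix n and x x' :: "'a stream" assume "stake n x = stake n x'"
  then have "cmod (f x - f x') \<le> K * \<theta> ^ n" by (rule holder_bound_diff[OF assms(1)])
  also have "\<dots> \<le> L * \<theta> ^ n" using assms(2) theta_pow[of n] by simp
  finally show "cmod (f x - f x') \<le> L * \<theta> ^ n" .
qed

lemma holder_bound_const: "holder_bound \<theta> (cmod c) (\<lambda>_. c)"
  using theta_pos by (intro holder_boundI) auto

lemma holder_bound_add:
  assumes "holder_bound \<theta> K f" "holder_bound \<theta> L g"
  shows "holder_bound \<theta> (K + L) (\<lambda>x. f x + g x)"
proof (rule holder_boundI)
  show "cmod (f x + g x) \<le> K + L" for x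
    using holder_bound_norm[OF assms(1)] holder_bound_norm[OF assms(2)]
    by (meson add_mono norm_triangle_le)
  fix n and x x' :: "'a stream" assume e: "stake n x = stake n x'"
  have "f x + g x - (f x' + g x') = (f x - f x') + (g x - g x')" by simp
  also have "cmod \<dots> \<le> K * \<theta> ^ n + L * \<theta> ^ n"
    using holder_bound_diff[OF assms(1) e] holder_bound_diff[OF assms(2) e]
    by (meson add_mono norm_triangle_le)
  finally show "cmod (f x + g x - (f x' + g x')) \<le> (K + L) * \<theta> ^ n" by (simp add: algebra_simps)
qed

lemma holder_bound_mult:
  assumes "holder_bound \<theta> K f" "holder_bound \<theta> L g"
  shows "holder_bound \<theta> (2 * K * L) (\<lambda>x. f x * g x)"
proof (rule holder_boundI)
  have KL: "0 \<le> K" "0 \<le> L" using assms by (auto dest: holder_bound_nonneg)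
  have "cmod (f x * g x) \<le> K * L" for x
    using holder_bound_norm[OF assms(1), of x] holder_bound_norm[OF assms(2), of x] KL
    by (simp add: norm_mult mult_mono)
  moreover have "K * L \<le> 2 * K * L" using mult_nonneg_nonneg[OF KL] by simp
  ultimately show "cmod (f x * g x) \<le> 2 * K * L" for x by (rule order_trans)
  fix n and x x' :: "'a stream" assume e: "stake n x = stake n x'"
  have "f x * g x - f x' * g x' = f x * (g x - g x') + (f x - f x') * g x'"
    by (simp add: algebra_simps)
  also have "cmod \<dots> \<le> K * (L * \<theta> ^ n) + (K * \<theta> ^ n) * L"
    using holder_bound_diff[OF assms(1) e] holder_bound_diff[OF assms(2) e] KL
      holder_bound_norm[OF assms(1), of x] holder_bound_norm[OF assms(2), of x'] theta_pow[of n]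
    by (intro norm_triangle_le add_mono) (auto simp: norm_mult intro!: mult_mono)
  finally show "cmod (f x * g x - f x' * g x') \<le> 2 * K * L * \<theta> ^ n" by (simp add: algebra_simps)
qed

lemma holder_bound_cmult:
  assumes "holder_bound \<theta> K f"
  shows "holder_bound \<theta> (cmod c * K) (\<lambda>x. c * f x)"
proof (rule holder_boundI)
  show "cmod (c * f x) \<le> cmod c * K" for x
    using holder_bound_norm[OF assms, of x] by (simp add: norm_mult mult_left_mono)
  fix n and x x' :: "'a stream" assume e: "stake n x = stake n x'"
  have "cmod (c * f x - c * f x') = cmod c * cmod (f x - f x')"
    by (simp flip: norm_mult add: algebra_simps)
  also have "\<dots> \<le> cmod c * (K * \<theta> ^ n)"
    using holder_bound_diff[OF assms e] by (simp add: mult_left_mono)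
  finally show "cmod (c * f x - c * f x') \<le> cmod c * K * \<theta> ^ n" by (simp add: mult.assoc)
qed

lemma holder_bound_uminus: "holder_bound \<theta> K f \<Longrightarrow> holder_bound \<theta> K (\<lambda>x. - f x)"
  using holder_bound_cmult[of K f "-1"] by simp

text \<open>
  The factor \<open>K\<close> outside the exponential matters: a small exponent gives a function that is close
  to \<open>1\<close> in the full Hoelder norm, and not only uniformly.
\<close>

lemma holder_bound_exp_minus_1:
  assumes "holder_bound \<theta> K f"
  shows "holder_bound \<theta> (exp K * K) (\<lambda>x. exp (f x) - 1)"
proof (rule holder_boundI)
  note b = holder_bound_norm[OF assms]
  have "cmod (exp (f x) - exp 0) \<le> exp K * cmod (f x - 0)" for x
    using b by (intro cmod_exp_diff_le) (auto intro: holder_bound_nonneg[OF assms])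
  also have "exp K * cmod (f x - 0) \<le> exp K * K" for x using b by simp
  finally show "cmod (exp (f x) - 1) \<le> exp K * K" for x by simp
  fix n and x x' :: "'a stream" assume e: "stake n x = stake n x'"
  have "cmod (exp (f x) - exp (f x')) \<le> exp K * cmod (f x - f x')"
    using b by (intro cmod_exp_diff_le) auto
  also have "\<dots> \<le> exp K * (K * \<theta> ^ n)" using holder_bound_diff[OF assms e] by simp
  finally show "cmod (exp (f x) - 1 - (exp (f x') - 1)) \<le> exp K * K * \<theta> ^ n" by simp
qed

lemma holder_bound_exp:
  assumes "holder_bound \<theta> K f"
  shows "holder_bound \<theta> (1 + exp K * K) (\<lambda>x. exp (f x))"
  using holder_bound_add[OF holder_bound_const[of 1] holder_bound_exp_minus_1[OF assms]] by simp

text \<open>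
  Prepending \<open>w\<close> makes any two points agree on \<open>length w\<close> further symbols. Freezing the tail at \<open>z\<close>
  therefore costs only \<open>\<theta> ^ length w\<close>, again in the full Hoelder norm; this is what allows a
  general functional to be replaced by a point evaluation in the limit.
\<close>

lemma holder_bound_shift_diff:
  assumes "holder_bound \<theta> K f"
  shows "holder_bound \<theta> (K * \<theta> ^ length w) (\<lambda>y. f (w @- y) - f (w @- z))"
proof (rule holder_boundI)
  show "cmod (f (w @- y) - f (w @- z)) \<le> K * \<theta> ^ length w" for y
    by (rule holder_bound_diff[OF assms]) (simp add: stake_shift)
  fix n and x x' :: "'a stream" assume "stake n x = stake n x'"
  then have "cmod (f (w @- x) - f (w @- x')) \<le> K * \<theta> ^ (length w + n)"
    by (intro holder_bound_diff[OF assms]) (simp only: stake_shift_eq_iff)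
  then show "cmod (f (w @- x) - f (w @- z) - (f (w @- x') - f (w @- z))) \<le> K * \<theta> ^ length w * \<theta> ^ n"
    by (simp add: power_add mult.assoc)
qed

lemma holder_bound_shift:
  assumes "holder_bound \<theta> K f"
  shows "holder_bound \<theta> K (\<lambda>y. f (w @- y))"
proof (rule holder_boundI)
  show "cmod (f (w @- x)) \<le> K" for x by (rule holder_bound_norm[OF assms])
  fix n and x x' :: "'a stream" assume "stake n x = stake n x'"
  then have "cmod (f (w @- x) - f (w @- x')) \<le> K * \<theta> ^ (length w + n)"
    by (intro holder_bound_diff[OF assms]) (simp only: stake_shift_eq_iff)
  also have "\<dots> \<le> K * \<theta> ^ n"
    using theta_pow holder_bound_nonneg[OF assms] theta_pos theta_less_1
    by (intro mult_left_mono power_decreasing) auto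
  finally show "cmod (f (w @- x) - f (w @- x')) \<le> K * \<theta> ^ n" .
qed

lemma Holder_iff_holder_bound: "f \<in> Holder \<theta> \<longleftrightarrow> (\<exists>K. holder_bound \<theta> K f)"
proof
  assume "f \<in> Holder \<theta>"
  then obtain C where C: "C \<ge> 0"
    "\<And>n x x'. stake n x = stake n x' \<Longrightarrow> cmod (f x - f x') \<le> C * \<theta> ^ n"
    by (auto simp: Holder_def)
  define p where "p = (undefined :: 'a stream)"
  have "holder_bound \<theta> (C + cmod (f p)) f"
  proof (rule holder_boundI)
    show "cmod (f x) \<le> C + cmod (f p)" for x
      using C(2)[of 0 x p] norm_triangle_sub[of "f x" "f p"] by simp
    show "cmod (f x - f x') \<le> (C + cmod (f p)) * \<theta> ^ n" if "stake n x = stake n x'" for n x x'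
    proof -
      have "C * \<theta> ^ n \<le> (C + cmod (f p)) * \<theta> ^ n"
        using theta_pow[of n] by (intro mult_right_mono) auto
      then show ?thesis using C(2)[OF that] by linarith
    qed
  qed
  then show "\<exists>K. holder_bound \<theta> K f" ..
next
  assume "\<exists>K. holder_bound \<theta> K f"
  then obtain K where "holder_bound \<theta> K f" ..
  then show "f \<in> Holder \<theta>"
    unfolding Holder_def using holder_bound_nonneg holder_bound_diff by blast
qed

lemma holder_bound_imp_Holder: "holder_bound \<theta> K f \<Longrightarrow> f \<in> Holder \<theta>"
  by (auto simp: Holder_iff_holder_bound)

lemma sup_norm_upper: "holder_bound \<theta> K f \<Longrightarrow> cmod (f x) \<le> sup_norm f"
  unfolding sup_norm_def by (rule cSUP_upper) (auto simp: bdd_above_def dest: holder_bound_norm)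

lemma holder_seminorm_quotient_le:
  assumes "holder_bound \<theta> K f" "stake n x = stake n x'"
  shows "cmod (f x - f x') / \<theta> ^ n \<le> K"
  using holder_bound_diff[OF assms] theta_pow[of n] by (simp add: divide_le_eq)

lemma holder_norm_le:
  assumes "holder_bound \<theta> K f"
  shows "holder_norm \<theta> f \<le> 2 * K"
proof -
  have "sup_norm f \<le> K"
    unfolding sup_norm_def by (rule cSUP_least) (auto intro: holder_bound_norm[OF assms])
  moreover have "holder_seminorm \<theta> f \<le> K"
    unfolding holder_seminorm_def
    by (rule cSUP_least) (auto intro!: holder_seminorm_quotient_le[OF assms] exI[of _ 1])
  ultimately show ?thesis by (simp add: holder_norm_def)
qed

text \<open>
  The seminorm starts at \<open>n = 1\<close>; at \<open>n = 0\<close> the oscillation is bounded by twice the supremum norm,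
  whence the factor \<open>2\<close>.
\<close>

lemma holder_bound_holder_norm:
  assumes "f \<in> Holder \<theta>"
  shows "holder_bound \<theta> (2 * holder_norm \<theta> f) f"
proof -
  obtain K where K: "holder_bound \<theta> K f" using assms Holder_iff_holder_bound by blast
  have s: "cmod (f x) \<le> sup_norm f" for x by (rule sup_norm_upper[OF K])
  then have s0: "0 \<le> sup_norm f" using norm_ge_zero order_trans by blast
  let ?S = "{(n, x, x'). n \<ge> 1 \<and> stake n x = stake n x'} :: (nat \<times> 'a stream \<times> 'a stream) set"
  have bdd: "bdd_above ((\<lambda>(n, x, x'). cmod (f x - f x') / \<theta> ^ n) ` ?S)"
    by (rule bdd_aboveI[where M = K]) (auto intro!: holder_seminorm_quotient_le[OF K])
  have h: "cmod (f x - f x') / \<theta> ^ n \<le> holder_seminorm \<theta> f" if "n \<ge> 1" "stake n x = stake n x'" for n x x'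
    unfolding holder_seminorm_def using that cSUP_upper[OF _ bdd, of "(n, x, x')"] by simp
  have h0: "0 \<le> holder_seminorm \<theta> f" using h[of 1 undefined undefined] by simp
  show ?thesis
  proof (rule holder_boundI)
    show "cmod (f x) \<le> 2 * holder_norm \<theta> f" for x
      using s[of x] s0 h0 by (simp add: holder_norm_def)
    fix n and x x' :: "'a stream" assume e: "stake n x = stake n x'"
    show "cmod (f x - f x') \<le> 2 * holder_norm \<theta> f * \<theta> ^ n"
    proof (cases "n = 0")
      case True
      have "cmod (f x - f x') \<le> 2 * sup_norm f"
        using norm_triangle_ineq4[of "f x" "f x'"] s[of x] s[of x'] by linarith
      then show ?thesis using True h0 by (simp add: holder_norm_def)
    next
      case False
      then have "cmod (f x - f x') \<le> holder_seminorm \<theta> f * \<theta> ^ n"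
        using h[OF _ e] theta_pow[of n] by (simp add: divide_le_eq)
      also have "\<dots> \<le> 2 * holder_norm \<theta> f * \<theta> ^ n"
        using s0 h0 theta_pow[of n] by (intro mult_right_mono) (auto simp: holder_norm_def)
      finally show ?thesis .
    qed
  qed
qed

lemma holder_norm_nonneg: "f \<in> Holder \<theta> \<Longrightarrow> 0 \<le> holder_norm \<theta> f"
  using holder_bound_nonneg[OF holder_bound_holder_norm] by fastforce

lemma Holder_add: "f \<in> Holder \<theta> \<Longrightarrow> g \<in> Holder \<theta> \<Longrightarrow> (\<lambda>x. f x + g x) \<in> Holder \<theta>"
  unfolding Holder_iff_holder_bound by (blast intro: holder_bound_add)

lemma Holder_mult: "f \<in> Holder \<theta> \<Longrightarrow> g \<in> Holder \<theta> \<Longrightarrow> (\<lambda>x. f x * g x) \<in> Holder \<theta>"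
  unfolding Holder_iff_holder_bound by (blast intro: holder_bound_mult)

lemma Holder_const: "(\<lambda>_. c) \<in> Holder \<theta>"
  using holder_bound_const Holder_iff_holder_bound by blast

lemma Holder_cmult: "f \<in> Holder \<theta> \<Longrightarrow> (\<lambda>x. c * f x) \<in> Holder \<theta>"
  by (rule Holder_mult[OF Holder_const])

lemma Holder_exp: "f \<in> Holder \<theta> \<Longrightarrow> (\<lambda>x. exp (f x)) \<in> Holder \<theta>"
  unfolding Holder_iff_holder_bound by (blast intro: holder_bound_exp)

lemma Holder_shift: "f \<in> Holder \<theta> \<Longrightarrow> (\<lambda>x. f (w @- x)) \<in> Holder \<theta>"
  unfolding Holder_iff_holder_bound by (blast intro: holder_bound_shift)

lemma Holder_sum:
  "finite I \<Longrightarrow> (\<And>i. i \<in> I \<Longrightarrow> f i \<in> Holder \<theta>) \<Longrightarrow> (\<lambda>x. \<Sum>i\<in>I. f i x) \<in> Holder \<theta>"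
  by (induction I rule: finite_induct) (auto intro: Holder_const Holder_add)

lemma Holder_ruelle:
  assumes "A \<in> Holder \<theta>" "\<phi> \<in> Holder \<theta>"
  shows "ruelle a A \<phi> \<in> Holder \<theta>"
proof -
  have "(\<lambda>x. exp (A ([j] @- x)) * \<phi> ([j] @- x)) \<in> Holder \<theta>" for j
    by (intro Holder_mult Holder_exp Holder_shift assms)
  then have "(\<lambda>x. \<Sum>j\<in>UNIV. complex_of_real (a j) * (exp (A ([j] @- x)) * \<phi> ([j] @- x))) \<in> Holder \<theta>"
    by (intro Holder_sum Holder_cmult) auto
  then show ?thesis
    by (simp add: ruelle_def[abs_def] integ_def scaleR_conv_of_real)
qed

end

text \<open>
  A cylinder restricts finitely many coordinates, so it is a basic open set of the product topology.
\<close>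

lemma openin_cylinder: "openin seq_topology {x. stake n x = stake n z}"
proof -
  let ?B = "\<lambda>i. if i < n then {z !! i} else UNIV"
  have "openin (product_topology (\<lambda>_. discrete_topology UNIV) UNIV) (PiE UNIV ?B)"
    by (rule product_topology_basis) (auto intro: finite_subset[of _ "{..<n}"])
  moreover have "{x. stake n x = stake n z} = snth -` PiE UNIV ?B \<inter> UNIV"
    by (auto simp: list_eq_iff_nth_eq PiE_iff split: if_splits)
  ultimately show ?thesis
    unfolding seq_topology_def openin_pullback_topology by blast
qed

lemma (in holder_exponent) Holder_subset_Cont: "Holder \<theta> \<subseteq> Cont"
proof
  fix f :: "'m stream \<Rightarrow> complex" assume "f \<in> Holder \<theta>"
  then obtain K where K: "holder_bound \<theta> K f" using Holder_iff_holder_bound by blast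
  have top: "topspace (seq_topology :: 'm stream topology) = UNIV"
    by (simp add: seq_topology_def topspace_pullback_topology)
  have "openin seq_topology {x. f x \<in> U}" if "open U" for U
  proof (subst openin_subopen, intro ballI)
    fix z assume "z \<in> {x. f x \<in> U}"
    then have "f z \<in> U" by simp
    with that obtain e where e: "e > 0" "ball (f z) e \<subseteq> U" by (rule openE)
    have "(\<lambda>n. K * \<theta> ^ n) \<longlonglongrightarrow> K * 0"
      using theta_pos theta_less_1 by (intro tendsto_intros LIMSEQ_power_zero) auto
    then obtain n where n: "K * \<theta> ^ n < e"
      using e(1) by (force dest!: order_tendstoD(2)[where a = e] simp: eventually_sequentially)
    have "{x. stake n x = stake n z} \<subseteq> {x. f x \<in> U}"
    proof clarify
      fix x assume "stake n x = stake n z"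
      then have "cmod (f x - f z) < e" using holder_bound_diff[OF K] n by fastforce
      then show "f x \<in> U" using e(2) by (auto simp: dist_norm norm_minus_commute)
    qed
    then show "\<exists>T. openin seq_topology T \<and> z \<in> T \<and> T \<subseteq> {x. f x \<in> U}"
      using openin_cylinder by blast
  qed
  then show "f \<in> Cont" by (auto simp: Cont_def continuous_map_def top)
qed

section \<open>Iterated integrals\<close>

text \<open>
  The iterated integral is a finite sum over words weighted by the product measure. In this form
  linearity, interchange of integrals and reversal of words are facts about finite sums.
\<close>

definition word_weight :: "('m \<Rightarrow> real) \<Rightarrow> 'm list \<Rightarrow> real" where
  "word_weight a w = prod_list (map a w)"

lemma word_weight_nonneg: "(\<And>j. a j \<ge> 0) \<Longrightarrow> 0 \<le> word_weight a w"
  by (induction w) (auto simp: word_weight_def)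

lemma word_weight_rev: "word_weight a (rev w) = word_weight a w"
  by (induction w) (auto simp: word_weight_def)

lemma finite_words: "finite {w :: 'm::finite list. length w = n}"
  using finite_lists_length_eq[of "UNIV :: 'm set" n] by simp

lemma iter_integ_eq_sum:
  fixes a :: "'m::finite \<Rightarrow> real"
  shows "iter_integ a n F = (\<Sum>w | length w = n. word_weight a w *\<^sub>R F w)"
proof (induction n arbitrary: F)
  case 0
  then show ?case by (simp add: word_weight_def)
next
  case (Suc n)
  have "{w :: 'm list. length w = Suc n} = (\<lambda>(j, w). j # w) ` (UNIV \<times> {w. length w = n})"
    by (auto simp: length_Suc_conv image_iff)
  moreover have "inj_on (\<lambda>(j, w). j # w) (UNIV \<times> {w :: 'm list. length w = n})"
    by (auto simp: inj_on_def)
  ultimately have "(\<Sum>w | length w = Suc n. word_weight a w *\<^sub>R F w)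
      = (\<Sum>(j, w)\<in>UNIV \<times> {w. length w = n}. (a j * word_weight a w) *\<^sub>R F (j # w))"
    by (simp add: sum.reindex case_prod_unfold word_weight_def)
  also have "\<dots> = iter_integ a (Suc n) F"
    by (simp add: Suc.IH integ_def scaleR_sum_right sum.cartesian_product)
  finally show ?case ..
qed

lemma iter_integ_cong:
  fixes a :: "'m::finite \<Rightarrow> real"
  shows "(\<And>w. length w = n \<Longrightarrow> F w = G w) \<Longrightarrow> iter_integ a n F = iter_integ a n G"
  by (simp add: iter_integ_eq_sum)

lemma iter_integ_norm_le:
  fixes a :: "'m::finite \<Rightarrow> real" and F :: "'m list \<Rightarrow> 'b::real_normed_vector"
  assumes "\<And>j. a j \<ge> 0" "\<And>w. length w = n \<Longrightarrow> norm (F w) \<le> G w"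
  shows "norm (iter_integ a n F) \<le> iter_integ a n G"
  unfolding iter_integ_eq_sum
proof (rule sum_norm_le)
  fix w :: "'m list" assume "w \<in> {w. length w = n}"
  then show "norm (word_weight a w *\<^sub>R F w) \<le> word_weight a w *\<^sub>R G w"
    using assms(2)[of w] word_weight_nonneg[of a w] assms(1) by (simp add: mult_left_mono)
qed

lemma iter_integ_mono:
  fixes a :: "'m::finite \<Rightarrow> real" and F G :: "'m list \<Rightarrow> real"
  assumes "\<And>j. a j \<ge> 0" "\<And>w. length w = n \<Longrightarrow> F w \<le> G w"
  shows "iter_integ a n F \<le> iter_integ a n G"
  unfolding iter_integ_eq_sum using assms
  by (auto intro!: sum_mono mult_left_mono word_weight_nonneg)

lemma iter_integ_cmult:
  fixes a :: "'m::finite \<Rightarrow> real" and c :: "'b::real_algebra"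
  shows "iter_integ a n (\<lambda>w. c * F w) = c * iter_integ a n F"
  by (simp add: iter_integ_eq_sum sum_distrib_left)

lemma iter_integ_add:
  fixes a :: "'m::finite \<Rightarrow> real"
  shows "iter_integ a n (\<lambda>w. F w + G w) = iter_integ a n F + iter_integ a n G"
  by (simp add: iter_integ_eq_sum scaleR_add_right sum.distrib)

lemma iter_integ_diff:
  fixes a :: "'m::finite \<Rightarrow> real"
  shows "iter_integ a n (\<lambda>w. F w - G w) = iter_integ a n F - iter_integ a n G"
  by (simp add: iter_integ_eq_sum scaleR_diff_right sum_subtractf)

lemma iter_integ_const:
  assumes "(\<Sum>j\<in>UNIV. a j) = 1"
  shows "iter_integ a n (\<lambda>_. c) = c"
  by (induction n) (use assms in \<open>simp_all add: integ_def flip: scaleR_left.sum\<close>)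

text \<open>
  The weight of a word is a product of numbers, so reading the word backwards does not change it. This
  reconciles the words \<open>x\<^sub>n \<dots> x\<^sub>1\<close> of the inverse formula with those \<open>x\<^sub>1 \<dots> x\<^sub>n\<close> in the growth rate.
\<close>

lemma iter_integ_rev:
  fixes a :: "'m::finite \<Rightarrow> real"
  shows "iter_integ a n (\<lambda>w. F (rev w)) = iter_integ a n F"
  unfolding iter_integ_eq_sum
  by (rule sum.reindex_bij_witness[of _ rev rev])
     (auto simp: word_weight_rev)

lemma iter_integ_swap:
  fixes a :: "'m::finite \<Rightarrow> real"
  shows "iter_integ a n (\<lambda>u. iter_integ a m (\<lambda>v. F u v)) = iter_integ a m (\<lambda>v. iter_integ a n (\<lambda>u. F u v))"
  unfolding iter_integ_eq_sum scaleR_sum_right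
  by (subst sum.swap) (simp add: mult.commute)

lemma iter_integ_append:
  fixes a :: "'m::finite \<Rightarrow> real"
  shows "iter_integ a (n + m) F = iter_integ a n (\<lambda>u. iter_integ a m (\<lambda>v. F (u @ v)))"
  by (induction n arbitrary: F) simp_all

lemma iter_integ_Suc_snoc:
  fixes a :: "'m::finite \<Rightarrow> real"
  shows "iter_integ a (Suc n) F = iter_integ a n (\<lambda>w. integ a (\<lambda>j. F (w @ [j])))"
  using iter_integ_append[of a n 1 F] by simp

lemma iter_integ_Suc_Cons:
  fixes a :: "'m::finite \<Rightarrow> real"
  shows "iter_integ a (Suc n) F = iter_integ a n (\<lambda>w. integ a (\<lambda>j. F (j # w)))"
  using iter_integ_append[of a 1 n F] iter_integ_swap[of a 1 n "\<lambda>u v. F (u @ v)"] by simp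

lemma integ_cmult:
  fixes c :: "'b::real_algebra"
  shows "integ a (\<lambda>j. c * F j) = c * integ a F"
  by (simp add: integ_def sum_distrib_left)

section \<open>Birkhoff sums and iterates of the Ruelle operator\<close>

lemma birkhoff_sum_0 [simp]: "birkhoff_sum A 0 x = 0"
  by (simp add: birkhoff_sum_def)

lemma birkhoff_sum_append:
  "length u = n \<Longrightarrow> birkhoff_sum A (n + m) (u @- x) = birkhoff_sum A n (u @- x) + birkhoff_sum A m x"
proof -
  assume u: "length u = n"
  have "(\<Sum>k<n + m. A (sdrop k (u @- x))) = (\<Sum>k<n. A (sdrop k (u @- x))) + (\<Sum>k<m. A (sdrop (k + n) (u @- x)))"
    using sum.atLeastLessThan_concat[of 0 n "n + m" "\<lambda>k. A (sdrop k (u @- x))"]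
      sum.shift_bounds_nat_ivl[of "\<lambda>k. A (sdrop k (u @- x))" 0 n m]
    by (simp add: atLeast0LessThan add.commute)
  also have "(\<Sum>k<m. A (sdrop (k + n) (u @- x))) = (\<Sum>k<m. A (sdrop k x))"
    using u by (simp add: sdrop_shift)
  finally show ?thesis by (simp add: birkhoff_sum_def)
qed

lemma birkhoff_sum_Cons: "birkhoff_sum A (Suc n) (j ## x) = A (j ## x) + birkhoff_sum A n x"
  using birkhoff_sum_append[of "[j]" 1 A n x] by (simp add: birkhoff_sum_def)

lemma birkhoff_sum_snoc:
  "length w = n \<Longrightarrow> birkhoff_sum A (Suc n) (w @- j ## x) = birkhoff_sum A n (w @- j ## x) + A (j ## x)"
  using birkhoff_sum_append[of w n A 1 "j ## x"] by (simp add: birkhoff_sum_def)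

lemma ruelle_funpow:
  "(ruelle a A ^^ n) \<phi> x = iter_integ a n (\<lambda>w. exp (birkhoff_sum A n (w @- x)) * \<phi> (w @- x))"
proof (induction n arbitrary: \<phi>)
  case (Suc n)
  have "(ruelle a A ^^ Suc n) \<phi> x = (ruelle a A ^^ n) (ruelle a A \<phi>) x"
    by (simp add: funpow_swap1)
  also have "\<dots> = iter_integ a n (\<lambda>w. integ a (\<lambda>j.
      exp (birkhoff_sum A (Suc n) (j ## w @- x)) * \<phi> (j ## w @- x)))"
    unfolding Suc.IH by (simp add: ruelle_def birkhoff_sum_Cons exp_add ac_simps flip: integ_cmult)
  also have "\<dots> = iter_integ a (Suc n) (\<lambda>w. exp (birkhoff_sum A (Suc n) (w @- x)) * \<phi> (w @- x))"
    by (subst iter_integ_Suc_Cons) simp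
  finally show ?case .
qed simp

section \<open>The growth rate\<close>

lemma subadditive_mult_le:
  fixes u :: "nat \<Rightarrow> real"
  assumes "\<And>m n. u (m + n) \<le> u m + u n"
  shows "u (q * m + r) \<le> real q * u m + u r"
proof (induction q)
  case (Suc q)
  have "u (Suc q * m + r) \<le> u m + u (q * m + r)"
    using assms[of m "q * m + r"] by (simp add: add.assoc)
  with Suc show ?case by (simp add: algebra_simps)
qed simp

text \<open>
  Fekete's lemma. Write \<open>n = q m + r\<close> with \<open>u m / m\<close> close to the infimum \<open>L\<close> of all quotients; then
  \<open>u n\<close> exceeds \<open>n (u m / m)\<close> by at most a constant that depends on \<open>m\<close> alone.
\<close>

lemma subadditive_convergent:
  fixes u :: "nat \<Rightarrow> real"
  assumes sub: "\<And>m n. u (m + n) \<le> u m + u n" and low: "\<And>n. - (K * real n) \<le> u n"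
  shows "convergent (\<lambda>n. u n / real n)"
proof -
  define L where "L = (INF n\<in>{1..}. u n / real n)"
  have ge: "- K \<le> u n / real n" if "n \<ge> 1" for n
    using low[of n] that by (simp add: le_divide_eq)
  have bdd: "bdd_below ((\<lambda>n. u n / real n) ` {1..})"
    by (rule bdd_belowI[where m = "- K"]) (use ge in auto)
  have L: "L \<le> u n / real n" if "n \<ge> 1" for n
    unfolding L_def using that by (intro cINF_lower[OF bdd]) auto
  have "(\<lambda>n. u n / real n) \<longlonglongrightarrow> L"
  proof (rule order_tendstoI)
    fix c assume "c < L"
    then show "\<forall>\<^sub>F n in sequentially. c < u n / real n"
      by (intro eventually_sequentiallyI[of 1]) (use L in force)
  next
    fix c assume "L < c"
    then obtain m where m: "m \<ge> 1" "u m / real m < c"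
      unfolding L_def using cINF_less_iff[OF _ bdd, of c] by auto
    define d where "d = u m / real m"
    define B where "B = (\<Sum>r<m. \<bar>u r\<bar>) + \<bar>real m * d\<bar>"
    have um: "u m = real m * d" using m(1) by (simp add: d_def)
    have upper: "u n / real n \<le> d + B / real n" if n: "n \<ge> 1" for n
    proof -
      define q r where "q = n div m" and "r = n mod m"
      have nqr: "n = q * m + r" and r: "r < m" using m(1) by (auto simp: q_def r_def)
      have "u n \<le> real q * u m + u r" unfolding nqr by (rule subadditive_mult_le[OF sub])
      moreover have "real q * u m = real n * d - real r * d"
        using nqr um by (simp add: algebra_simps)
      moreover have "u r \<le> (\<Sum>r<m. \<bar>u r\<bar>)"
        using member_le_sum[of r "{..<m}" "\<lambda>r. \<bar>u r\<bar>"] r by simp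
      moreover have "- (real r * d) \<le> real r * \<bar>d\<bar>"
        using mult_left_mono[of "- d" "\<bar>d\<bar>" "real r"] by simp
      moreover have "real r * \<bar>d\<bar> \<le> real m * \<bar>d\<bar>"
        using r by (intro mult_right_mono) auto
      ultimately have "u n \<le> real n * d + B" by (simp add: B_def abs_mult)
      then show ?thesis using n by (simp add: field_simps)
    qed
    have "(\<lambda>n. d + B / real n) \<longlonglongrightarrow> d + 0"
      by (intro tendsto_intros lim_const_over_n)
    then have "\<forall>\<^sub>F n in sequentially. d + B / real n < c"
      using m(2) by (intro order_tendstoD(2)) (auto simp: d_def)
    then show "\<forall>\<^sub>F n in sequentially. u n / real n < c"
      using eventually_ge_at_top[of 1] by eventually_elim (use upper in force)
  qed
  then show ?thesis by (rule convergentI)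
qed

text \<open>
  Fekete's lemma for the logarithm of \<open>S\<close>.
\<close>

lemma submultiplicative_root_convergent:
  fixes S :: "nat \<Rightarrow> real"
  assumes sub: "\<And>m n. S (m + n) \<le> S m * S n" and low: "\<And>n. exp (- (K * real n)) \<le> S n"
  shows "convergent (\<lambda>n. root n (S n))"
proof -
  have pos: "0 < S n" for n using low[of n] exp_gt_zero[of "- (K * real n)"] by linarith
  have "convergent (\<lambda>n. ln (S n) / real n)"
  proof (rule subadditive_convergent[where K = K])
    show "ln (S (m + n)) \<le> ln (S m) + ln (S n)" for m n
      using sub[of m n] pos by (simp flip: ln_mult_pos)
    show "- (K * real n) \<le> ln (S n)" for n
      using low[of n] pos[of n] ln_ge_iff by blast
  qed
  then obtain L where "(\<lambda>n. ln (S n) / real n) \<longlonglongrightarrow> L" by (auto simp: convergent_def)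
  then have "(\<lambda>n. exp (ln (S n) / real n)) \<longlonglongrightarrow> exp L" by (rule tendsto_exp)
  moreover have "\<forall>\<^sub>F n in sequentially. exp (ln (S n) / real n) = root n (S n)"
    using eventually_gt_at_top[of 0]
  proof eventually_elim
    case (elim n)
    then show ?case using pos[of n] by (simp add: root_powr_inverse powr_def)
  qed
  ultimately have "(\<lambda>n. root n (S n)) \<longlonglongrightarrow> exp L" by (rule Lim_transform_eventually)
  then show ?thesis by (rule convergentI)
qed

definition partition_sup :: "('m::finite \<Rightarrow> real) \<Rightarrow> ('m stream \<Rightarrow> complex) \<Rightarrow> nat \<Rightarrow> real" where
  "partition_sup a A n = (SUP x. iter_integ a n (\<lambda>w. exp (Re (birkhoff_sum A n (w @- x)))))"

locale transfer_potential = holder_exponent \<theta> for \<theta> +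
  fixes a :: "'m::finite \<Rightarrow> real" and A :: "'m stream \<Rightarrow> complex"
  assumes a_nonneg: "\<And>j. a j \<ge> 0" and a_sum: "(\<Sum>j\<in>UNIV. a j) = 1"
    and A_Holder: "A \<in> Holder \<theta>"
begin

lemma birkhoff_sum_bounded:
  obtains K where "\<And>n x. \<bar>Re (birkhoff_sum A n x)\<bar> \<le> K * real n"
proof -
  obtain K where K: "holder_bound \<theta> K A" using A_Holder Holder_iff_holder_bound by blast
  show ?thesis
  proof
    fix n x
    have "\<bar>Re (birkhoff_sum A n x)\<bar> \<le> cmod (birkhoff_sum A n x)" by (rule abs_Re_le_cmod)
    also have "\<dots> \<le> (\<Sum>k<n. K)"
      unfolding birkhoff_sum_def by (rule sum_norm_le) (rule holder_bound_norm[OF K])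
    finally show "\<bar>Re (birkhoff_sum A n x)\<bar> \<le> K * real n" by (simp add: mult.commute)
  qed
qed

lemma partition_integral_le:
  "iter_integ a n (\<lambda>w. exp (Re (birkhoff_sum A n (w @- x)))) \<le> partition_sup a A n"
proof -
  obtain K where K: "\<And>n x. \<bar>Re (birkhoff_sum A n x)\<bar> \<le> K * real n"
    using birkhoff_sum_bounded by blast
  have "iter_integ a n (\<lambda>w. exp (Re (birkhoff_sum A n (w @- x)))) \<le> exp (K * real n)" for x
  proof -
    have "iter_integ a n (\<lambda>w. exp (Re (birkhoff_sum A n (w @- x)))) \<le> iter_integ a n (\<lambda>_. exp (K * real n))"
      by (rule iter_integ_mono[OF a_nonneg]) (use K in \<open>simp add: abs_le_iff\<close>)
    then show ?thesis by (simp add: iter_integ_const[OF a_sum])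
  qed
  then show ?thesis unfolding partition_sup_def by (intro cSUP_upper) (auto simp: bdd_above_def)
qed

lemma partition_integral_rev_le:
  "iter_integ a n (\<lambda>w. exp (Re (birkhoff_sum A n (rev w @- x)))) \<le> partition_sup a A n"
  using partition_integral_le[of n x]
  by (subst iter_integ_rev[of a n "\<lambda>w. exp (Re (birkhoff_sum A n (w @- x)))"])

text \<open>
  The Birkhoff sum over \<open>u v x\<close> splits into the one along \<open>u\<close>, started at \<open>v x\<close>, and the one along
  \<open>v\<close>. Integrating over \<open>u\<close> first bounds the inner integral by the supremum over all base points.
\<close>

lemma partition_sup_submultiplicative:
  "partition_sup a A (n + m) \<le> partition_sup a A n * partition_sup a A m"
proof -
  let ?e = "\<lambda>n x. exp (Re (birkhoff_sum A n x))"
  have "iter_integ a (n + m) (\<lambda>w. ?e (n + m) (w @- x)) \<le> partition_sup a A n * partition_sup a A m" for x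
  proof -
    have nonneg: "0 \<le> partition_sup a A n"
    proof -
      have "iter_integ a n (\<lambda>w. 0) \<le> iter_integ a n (\<lambda>w. ?e n (w @- x))"
        by (rule iter_integ_mono[OF a_nonneg]) simp
      then show ?thesis using partition_integral_le[of n x] by (simp add: iter_integ_const[OF a_sum])
    qed
    have "iter_integ a (n + m) (\<lambda>w. ?e (n + m) (w @- x))
        = iter_integ a n (\<lambda>u. iter_integ a m (\<lambda>v. ?e n (u @- v @- x) * ?e m (v @- x)))"
      unfolding iter_integ_append
      by (intro iter_integ_cong) (simp add: birkhoff_sum_append exp_add)
    also have "\<dots> = iter_integ a m (\<lambda>v. iter_integ a n (\<lambda>u. ?e m (v @- x) * ?e n (u @- v @- x)))"
      by (subst iter_integ_swap) (simp add: mult.commute)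
    also have "\<dots> = iter_integ a m (\<lambda>v. ?e m (v @- x) * iter_integ a n (\<lambda>u. ?e n (u @- v @- x)))"
      by (simp add: iter_integ_cmult)
    also have "\<dots> \<le> iter_integ a m (\<lambda>v. partition_sup a A n * ?e m (v @- x))"
      by (rule iter_integ_mono[OF a_nonneg])
         (simp add: mult.commute mult_right_mono partition_integral_le)
    also have "\<dots> \<le> partition_sup a A n * partition_sup a A m"
      unfolding iter_integ_cmult by (rule mult_left_mono[OF partition_integral_le nonneg])
    finally show ?thesis .
  qed
  then show ?thesis unfolding partition_sup_def[of a A "n + m"] by (intro cSUP_least) auto
qed

lemma partition_sup_lower: obtains K where "\<And>n. exp (- (K * real n)) \<le> partition_sup a A n"
proof -
  obtain K where K: "\<And>n x. \<bar>Re (birkhoff_sum A n x)\<bar> \<le> K * real n"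
    using birkhoff_sum_bounded by blast
  have "exp (- (K * real n)) \<le> partition_sup a A n" for n
  proof -
    have "- (K * real n) \<le> Re (birkhoff_sum A n x)" for x using K[of n x] by linarith
    then have "iter_integ a n (\<lambda>_. exp (- (K * real n)))
        \<le> iter_integ a n (\<lambda>w. exp (Re (birkhoff_sum A n (w @- undefined))))"
      by (intro iter_integ_mono[OF a_nonneg]) simp
    then show ?thesis
      using partition_integral_le[of n undefined] by (simp add: iter_integ_const[OF a_sum])
  qed
  then show ?thesis using that by blast
qed

lemma partition_sup_pos: "0 < partition_sup a A n"
  using partition_sup_lower by (metis exp_gt_zero less_le_trans)

lemma rho_seq_eq: "rho_seq a A = (\<lambda>n. root n (partition_sup a A n))"
  by (simp add: rho_seq_def partition_sup_def fun_eq_iff)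

lemma rho_seq_convergent: "convergent (rho_seq a A)"
proof -
  obtain K where "\<And>n. exp (- (K * real n)) \<le> partition_sup a A n" using partition_sup_lower by blast
  then show ?thesis
    unfolding rho_seq_eq
    by (intro submultiplicative_root_convergent partition_sup_submultiplicative)
qed

lemma rho_seq_tendsto: "(\<lambda>n. root n (partition_sup a A n)) \<longlonglongrightarrow> rho a A"
  using rho_seq_convergent unfolding rho_def by (simp add: convergent_LIMSEQ_iff rho_seq_eq)

lemma rho_nonneg: "0 \<le> rho a A"
  by (rule LIMSEQ_le_const[OF rho_seq_tendsto])
     (auto intro!: real_root_ge_zero less_imp_le[OF partition_sup_pos])

end

text \<open>
  The series of increments converges absolutely. The resulting bound on the limit will make the
  limit functional continuous.
\<close>

lemma convergent_if_increments_summable: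
  fixes f :: "nat \<Rightarrow> 'b::banach"
  assumes inc: "\<And>n. norm (f (Suc n) - f n) \<le> g n" and g: "summable g"
  shows "convergent f" "norm (lim f) \<le> norm (f 0) + suminf g"
proof -
  let ?d = "\<lambda>n. f (Suc n) - f n"
  have d: "summable ?d" by (rule summable_comparison_test'[OF g, of 0]) (use inc in auto)
  have "(\<lambda>n. f 0 + (\<Sum>k<n. ?d k)) \<longlonglongrightarrow> f 0 + suminf ?d"
    by (intro tendsto_intros summable_LIMSEQ d)
  then have lim: "f \<longlonglongrightarrow> f 0 + suminf ?d" by (simp add: sum_lessThan_telescope)
  then show "convergent f" by (rule convergentI)
  have "norm (suminf ?d) \<le> suminf g" by (rule norm_suminf_le[OF inc g])
  then show "norm (lim f) \<le> norm (f 0) + suminf g"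
    using limI[OF lim] norm_triangle_ineq[of "f 0" "suminf ?d"] by simp
qed

locale transfer_eigenvalue = transfer_potential \<theta> a A
  for \<theta> and a :: "'m::finite \<Rightarrow> real" and A :: "'m stream \<Rightarrow> complex" +
  fixes l :: complex
  assumes l_large: "cmod l > rho a A * \<theta>"
begin

text \<open>
  This is where the hypothesis on \<open>l\<close> enters: the integral over words of length \<open>n\<close> grows like
  \<open>rho ^ n\<close>, regularity of the integrand supplies \<open>\<theta> ^ n\<close>, and dividing by \<open>l ^ n\<close> leaves a sequence
  that is summable by the root test.
\<close>

definition decay :: "nat \<Rightarrow> real" where
  "decay n = partition_sup a A n * \<theta> ^ n / cmod l ^ n"

lemma l_nonzero: "l \<noteq> 0"
  using l_large rho_nonneg theta_pos by (smt (verit) mult_nonneg_nonneg norm_zero)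

lemma decay_nonneg: "0 \<le> decay n"
  using partition_sup_pos[of n] theta_pow[of n] by (simp add: decay_def)

lemma summable_decay: "summable decay"
proof (rule root_test_convergence)
  have "(\<lambda>n. root n (partition_sup a A n) * (\<theta> / cmod l)) \<longlonglongrightarrow> rho a A * (\<theta> / cmod l)"
    by (intro tendsto_intros rho_seq_tendsto)
  moreover have "\<forall>\<^sub>F n in sequentially.
      root n (partition_sup a A n) * (\<theta> / cmod l) = root n (norm (decay n))"
    using eventually_gt_at_top[of 0]
  proof eventually_elim
    case (elim n)
    have "norm (decay n) = partition_sup a A n * (\<theta> / cmod l) ^ n"
      using abs_of_nonneg[OF decay_nonneg[of n]] by (simp add: decay_def power_divide)
    then show ?case using elim theta_pos by (simp add: real_root_mult real_root_power_cancel)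
  qed
  ultimately show "(\<lambda>n. root n (norm (decay n))) \<longlonglongrightarrow> rho a A * (\<theta> / cmod l)"
    by (rule Lim_transform_eventually)
  show "rho a A * (\<theta> / cmod l) < 1"
    using l_large l_nonzero by (simp add: divide_less_eq)
qed

text \<open>
  The form in which all error terms are estimated: the integrand carries the Birkhoff weight together
  with a factor \<open>\<theta> ^ n\<close> that comes from two points agreeing on \<open>n\<close> symbols.
\<close>

lemma integral_le_decay:
  assumes "0 \<le> B"
    and "\<And>w. length w = n \<Longrightarrow> cmod (F w) \<le> B * \<theta> ^ n * exp (Re (birkhoff_sum A n (rev w @- x)))"
  shows "cmod (iter_integ a n F / l ^ n) \<le> B * decay n"
proof -
  have "cmod (iter_integ a n F)
      \<le> iter_integ a n (\<lambda>w. B * \<theta> ^ n * exp (Re (birkhoff_sum A n (rev w @- x))))"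
    by (rule iter_integ_norm_le[OF a_nonneg assms(2)])
  also have "\<dots> \<le> B * \<theta> ^ n * partition_sup a A n"
    unfolding iter_integ_cmult using assms(1) theta_pow[of n]
    by (intro mult_left_mono partition_integral_rev_le) auto
  finally have "cmod (iter_integ a n F) / cmod l ^ n \<le> B * \<theta> ^ n * partition_sup a A n / cmod l ^ n"
    by (rule divide_right_mono) simp
  then show ?thesis by (simp add: decay_def norm_divide norm_power mult.commute mult.left_commute)
qed

lemma tendsto_0_if_le_decay:
  assumes "\<And>n. cmod (f n) \<le> B * decay n"
  shows "f \<longlonglongrightarrow> 0"
proof (rule Lim_null_comparison)
  show "\<forall>\<^sub>F n in sequentially. cmod (f n) \<le> B * decay n" using assms by simp
  show "(\<lambda>n. B * decay n) \<longlonglongrightarrow> 0"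
    using tendsto_mult_left[OF summable_LIMSEQ_zero[OF summable_decay], of B] by simp
qed

end

section \<open>Functionals on the space of Hoelder functions\<close>

context holder_exponent
begin

lemma Holder_dual_add:
  "D \<in> Holder_dual \<theta> \<Longrightarrow> f \<in> Holder \<theta> \<Longrightarrow> g \<in> Holder \<theta> \<Longrightarrow> D (\<lambda>y. f y + g y) = D f + D g"
  by (simp add: Holder_dual_def)

lemma Holder_dual_cmult:
  "D \<in> Holder_dual \<theta> \<Longrightarrow> f \<in> Holder \<theta> \<Longrightarrow> D (\<lambda>y. c * f y) = c * D f"
  by (simp add: Holder_dual_def)

lemma Holder_dual_diff:
  assumes "D \<in> Holder_dual \<theta>" "f \<in> Holder \<theta>" "g \<in> Holder \<theta>"
  shows "D (\<lambda>y. f y - g y) = D f - D g"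
  using Holder_dual_add[OF assms(1,2) Holder_cmult[OF assms(3)], of "-1"]
    Holder_dual_cmult[OF assms(1,3), of "-1"] by simp

lemma Holder_dual_sum:
  assumes D: "D \<in> Holder_dual \<theta>" and "finite I" "\<And>i. i \<in> I \<Longrightarrow> f i \<in> Holder \<theta>"
  shows "D (\<lambda>y. \<Sum>i\<in>I. f i y) = (\<Sum>i\<in>I. D (f i))"
  using assms(2,3)
proof (induction I rule: finite_induct)
  case empty
  show ?case using Holder_dual_cmult[OF D Holder_const[of 0], of 0] by simp
next
  case (insert i I)
  have "D (\<lambda>y. f i y + (\<Sum>i\<in>I. f i y)) = D (f i) + D (\<lambda>y. \<Sum>i\<in>I. f i y)"
    using insert by (intro Holder_dual_add[OF D] Holder_sum) auto
  then show ?case using insert by simp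
qed

lemma Holder_dual_scaleR_sum:
  assumes D: "D \<in> Holder_dual \<theta>" and "finite I" "\<And>i. i \<in> I \<Longrightarrow> f i \<in> Holder \<theta>"
  shows "D (\<lambda>y. \<Sum>i\<in>I. c i *\<^sub>R f i y) = (\<Sum>i\<in>I. c i *\<^sub>R D (f i))"
proof -
  have "D (\<lambda>y. \<Sum>i\<in>I. complex_of_real (c i) * f i y) = (\<Sum>i\<in>I. D (\<lambda>y. complex_of_real (c i) * f i y))"
    using assms by (intro Holder_dual_sum Holder_cmult) auto
  also have "\<dots> = (\<Sum>i\<in>I. complex_of_real (c i) * D (f i))"
    using assms by (intro sum.cong Holder_dual_cmult) auto
  finally show ?thesis by (simp add: scaleR_conv_of_real)
qed

lemma Holder_dual_integ:
  assumes "D \<in> Holder_dual \<theta>" "\<And>j. F j \<in> Holder \<theta>"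
  shows "D (\<lambda>y. integ a (\<lambda>j. F j y)) = integ a (\<lambda>j. D (F j))"
  unfolding integ_def using assms by (intro Holder_dual_scaleR_sum) auto

lemma Holder_dual_iter_integ:
  fixes a :: "'m::finite \<Rightarrow> real"
  assumes "D \<in> Holder_dual \<theta>" "\<And>w. length w = n \<Longrightarrow> F w \<in> Holder \<theta>"
  shows "D (\<lambda>y. iter_integ a n (\<lambda>w. F w y)) = iter_integ a n (\<lambda>w. D (F w))"
  unfolding iter_integ_eq_sum using assms finite_words by (intro Holder_dual_scaleR_sum) auto

lemma Holder_dual_bound:
  fixes D :: "('m stream \<Rightarrow> complex) \<Rightarrow> complex"
  assumes "D \<in> Holder_dual \<theta>"
  obtains C where "0 \<le> C" "\<And>K f. holder_bound \<theta> K f \<Longrightarrow> cmod (D f) \<le> C * K"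
proof -
  obtain C where C: "\<And>f. f \<in> Holder \<theta> \<Longrightarrow> cmod (D f) \<le> C * holder_norm \<theta> f"
    using assms unfolding Holder_dual_def by blast
  show ?thesis
  proof
    show "0 \<le> 2 * \<bar>C\<bar>" by simp
    fix K and f :: "'m stream \<Rightarrow> complex" assume f: "holder_bound \<theta> K f"
    then have H: "f \<in> Holder \<theta>" by (rule holder_bound_imp_Holder)
    have "cmod (D f) \<le> C * holder_norm \<theta> f" by (rule C[OF H])
    also have "\<dots> \<le> \<bar>C\<bar> * (2 * K)"
      using holder_norm_le[OF f] holder_norm_nonneg[OF H] by (intro mult_mono) auto
    finally show "cmod (D f) \<le> 2 * \<bar>C\<bar> * K" by simp
  qed
qed

lemma dual_norm_upper:
  assumes D: "D \<in> Holder_dual \<theta>" and f: "f \<in> Holder \<theta>"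
  shows "cmod (D f) \<le> dual_norm \<theta> D * holder_norm \<theta> f"
proof -
  obtain C where C: "\<And>f. f \<in> Holder \<theta> \<Longrightarrow> cmod (D f) \<le> C * holder_norm \<theta> f"
    using D unfolding Holder_dual_def by blast
  have "cmod (D g) / holder_norm \<theta> g \<le> \<bar>C\<bar>" if "g \<in> Holder \<theta>" for g
  proof (cases "holder_norm \<theta> g = 0")
    case False
    then have "holder_norm \<theta> g > 0" using holder_norm_nonneg[OF that] by simp
    moreover have "cmod (D g) \<le> \<bar>C\<bar> * holder_norm \<theta> g"
      using C[OF that] mult_right_mono[OF abs_ge_self holder_norm_nonneg[OF that], of C] by linarith
    ultimately show ?thesis by (simp add: divide_le_eq)
  qed simp
  then have "bdd_above ((\<lambda>g. cmod (D g) / holder_norm \<theta> g) ` Holder \<theta>)" by (auto simp: bdd_above_def)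
  then have q: "cmod (D f) / holder_norm \<theta> f \<le> dual_norm \<theta> D"
    unfolding dual_norm_def using f by (rule cSUP_upper2) simp
  show ?thesis
  proof (cases "holder_norm \<theta> f = 0")
    case True
    then show ?thesis using C[OF f] by simp
  next
    case False
    then show ?thesis using q holder_norm_nonneg[OF f] by (simp add: divide_le_eq split: if_splits)
  qed
qed

end

section \<open>The involution kernel\<close>

locale involution = transfer_potential \<theta> a A
  for \<theta> and a :: "'m::finite \<Rightarrow> real" and A :: "'m stream \<Rightarrow> complex" +
  fixes Astar :: "'m stream \<Rightarrow> complex" and W :: "'m stream \<times> 'm stream \<Rightarrow> complex"
  assumes Astar_Holder: "Astar \<in> Holder \<theta>" and W_Holder: "W \<in> Holder_X \<theta>"
    and kernel: "involution_kernel A Astar W"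
begin

lemma kernel_Cons: "Astar (j ## y) + W (j ## y, x) = A (j ## x) + W (y, j ## x)"
  using kernel[unfolded involution_kernel_def, rule_format, of "j ## y" x] by simp

text \<open>
  The iterated kernel identity: moving the word \<open>w\<close> symbol by symbol from \<open>\<Omega>\<^sup>\<star>\<close> to \<open>\<Omega>\<close> trades \<open>Astar\<close>
  for \<open>A\<close> along the way. On the other side the word arrives reversed.
\<close>

lemma birkhoff_sum_cocycle:
  "birkhoff_sum Astar (length w) (w @- y) + W (w @- y, x)
     = birkhoff_sum A (length w) (rev w @- x) + W (y, rev w @- x)"
proof (induction w arbitrary: x)
  case (Cons j w)
  have "birkhoff_sum Astar (length (j # w)) ((j # w) @- y) + W ((j # w) @- y, x)
      = A (j ## x) + (birkhoff_sum Astar (length w) (w @- y) + W (w @- y, j ## x))"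
    using kernel_Cons[of j "w @- y" x] by (simp add: birkhoff_sum_Cons)
  also have "\<dots> = A (j ## x) + (birkhoff_sum A (length w) (rev w @- j ## x) + W (y, rev w @- j ## x))"
    by (simp only: Cons.IH)
  also have "\<dots> = birkhoff_sum A (length (j # w)) (rev (j # w) @- x) + W (y, rev (j # w) @- x)"
    by (simp add: birkhoff_sum_snoc)
  finally show ?case .
qed simp

text \<open>
  The weights of the iterates of the two Ruelle operators differ by the factor
  \<open>exp (W (y, rev w @- x)) * exp (- W (w @- y, x))\<close>. Its first part is what a functional on \<open>\<Omega>\<^sup>\<star>\<close> turns
  into a value of its image under the kernel map.
\<close>

lemma dual_weight_eq:
  assumes "length w = n"
  shows "exp (birkhoff_sum Astar n (w @- y))
    = exp (birkhoff_sum A n (rev w @- x)) * (exp (W (y, rev w @- x)) * exp (- W (w @- y, x)))"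
proof -
  have "birkhoff_sum Astar n (w @- y)
      = birkhoff_sum A n (rev w @- x) + (W (y, rev w @- x) + - W (w @- y, x))"
    using birkhoff_sum_cocycle[of w y x] assms by (simp add: algebra_simps)
  then show ?thesis by (simp only: exp_add)
qed

lemma kernel_Holder_constant:
  obtains C where "0 \<le> C"
    "\<And>n x x' y y'. stake n x = stake n x' \<Longrightarrow> stake n y = stake n y' \<Longrightarrow>
       cmod (W (y, x) - W (y', x')) \<le> C * \<theta> ^ n"
  using W_Holder unfolding Holder_X_def by blast

lemma kernel_sections_bound:
  obtains K where "\<And>x. holder_bound \<theta> K (\<lambda>y. W (y, x))" "\<And>y. holder_bound \<theta> K (\<lambda>x. W (y, x))"
proof -
  obtain C where C: "0 \<le> C"
    "\<And>n x x' y y'. stake n x = stake n x' \<Longrightarrow> stake n y = stake n y' \<Longrightarrow>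
       cmod (W (y, x) - W (y', x')) \<le> C * \<theta> ^ n"
    by (rule kernel_Holder_constant) (rule that)
  define p where "p = W (undefined, undefined)"
  have norm: "cmod (W (y, x)) \<le> C + cmod p" for x y
    using C(2)[of 0 x undefined y undefined] norm_triangle_sub[of "W (y, x)" p] by (simp add: p_def)
  have diff: "cmod (W (y, x) - W (y', x')) \<le> (C + cmod p) * \<theta> ^ n"
    if "stake n x = stake n x'" "stake n y = stake n y'" for n x x' y y'
  proof -
    have "C * \<theta> ^ n \<le> (C + cmod p) * \<theta> ^ n"
      using theta_pow[of n] by (intro mult_right_mono) auto
    then show ?thesis using C(2)[OF that] by linarith
  qed
  show ?thesis
    by (rule that[of "C + cmod p"]; rule holder_boundI) (use norm diff in auto)
qed

lemma exp_kernel_sections_bound: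
  obtains K where "\<And>x. holder_bound \<theta> K (\<lambda>y. exp (W (y, x)))"
    "\<And>x. holder_bound \<theta> K (\<lambda>y. exp (- W (y, x)))"
    "\<And>y. holder_bound \<theta> K (\<lambda>x. exp (- W (y, x)))"
proof -
  obtain K where "\<And>x. holder_bound \<theta> K (\<lambda>y. W (y, x))" "\<And>y. holder_bound \<theta> K (\<lambda>x. W (y, x))"
    by (rule kernel_sections_bound) (rule that)
  then show ?thesis
    by (intro that[of "1 + exp K * K"] holder_bound_exp holder_bound_uminus) auto
qed

lemma exp_kernel_Holder: "(\<lambda>y. exp (W (y, x))) \<in> Holder \<theta>"
proof -
  obtain E where E: "\<And>x. holder_bound \<theta> E (\<lambda>y. exp (W (y, x)))"
    "\<And>x. holder_bound \<theta> E (\<lambda>y. exp (- W (y, x)))"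
    "\<And>y. holder_bound \<theta> E (\<lambda>x. exp (- W (y, x)))"
    by (rule exp_kernel_sections_bound) (rule that)
  show ?thesis by (rule holder_bound_imp_Holder[OF E(1)])
qed

text \<open>
  The sections \<open>W (\<cdot>, x)\<close> depend on \<open>x\<close> in a Hoelder way with respect to the Hoelder norm on \<open>\<Omega>\<^sup>\<star>\<close>.
  Regularity of \<open>W\<close> alone would only give this for the supremum norm: a mixed difference over
  \<open>x \<sim>\<^sub>n x'\<close> and \<open>y \<sim>\<^sub>m y'\<close> would only be bounded by the smaller of \<open>\<theta> ^ n\<close> and \<open>\<theta> ^ m\<close>,
  not by their product. The kernel identity gives the product: the common first \<open>m\<close> symbols of
  \<open>y\<close> and \<open>y'\<close> can be moved in front of \<open>x\<close> and \<open>x'\<close>, which then agree on \<open>n + m\<close> symbols.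
\<close>

lemma kernel_section_lipschitz:
  obtains K where "0 \<le> K"
    "\<And>n x x'. stake n x = stake n x' \<Longrightarrow> holder_bound \<theta> (K * \<theta> ^ n) (\<lambda>y. W (y, x) - W (y, x'))"
proof -
  obtain C where C: "0 \<le> C"
    "\<And>n x x' y y'. stake n x = stake n x' \<Longrightarrow> stake n y = stake n y' \<Longrightarrow>
       cmod (W (y, x) - W (y', x')) \<le> C * \<theta> ^ n"
    by (rule kernel_Holder_constant) (rule that)
  have "holder_bound \<theta> (2 * C * \<theta> ^ n) (\<lambda>y. W (y, x) - W (y, x'))"
    if e: "stake n x = stake n x'" for n x x'
  proof (rule holder_boundI)
    fix y
    have "C * \<theta> ^ n \<le> 2 * C * \<theta> ^ n" using C(1) theta_pow[of n] by simp
    then show "cmod (W (y, x) - W (y, x')) \<le> 2 * C * \<theta> ^ n"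
      using C(2)[OF e refl, of y] by linarith
  next
    fix m and y y' :: "'m stream" assume yy: "stake m y = stake m y'"
    define w where "w = stake m y"
    define v v' where "v = sdrop m y" and "v' = sdrop m y'"
    have len: "length w = m" by (simp add: w_def)
    have y: "w @- v = y" and y': "w @- v' = y'"
      by (simp_all add: w_def v_def stake_sdrop) (simp add: yy v'_def stake_sdrop)
    have tail: "cmod (W (u, rev w @- x) - W (u, rev w @- x')) \<le> C * \<theta> ^ (n + m)" for u
      using C(2)[of "length (rev w) + n" "rev w @- x" "rev w @- x'" u u] e
      by (simp add: stake_shift len add.commute)
    (* In k and k' the Birkhoff sum of A depends on u only and the one of Astar on y or y' only;
       both disappear from the mixed difference. *)
    have k: "W (y, u) = birkhoff_sum A m (rev w @- u) + W (v, rev w @- u) - birkhoff_sum Astar m y" for u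
      using birkhoff_sum_cocycle[of w v u] by (simp add: y len eq_diff_eq add.commute)
    have k': "W (y', u) = birkhoff_sum A m (rev w @- u) + W (v', rev w @- u) - birkhoff_sum Astar m y'" for u
      using birkhoff_sum_cocycle[of w v' u] by (simp add: y' len eq_diff_eq add.commute)
    have "W (y, x) - W (y, x') - (W (y', x) - W (y', x'))
        = (W (v, rev w @- x) - W (v, rev w @- x')) - (W (v', rev w @- x) - W (v', rev w @- x'))"
      unfolding k k' by (simp only: algebra_simps)
    also have "cmod \<dots> \<le> C * \<theta> ^ (n + m) + C * \<theta> ^ (n + m)"
      using tail[of v] tail[of v'] by (meson add_mono norm_triangle_le_diff)
    finally show "cmod (W (y, x) - W (y, x') - (W (y', x) - W (y', x'))) \<le> 2 * C * \<theta> ^ n * \<theta> ^ m"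
      by (simp add: power_add ac_simps)
  qed
  from that[of "2 * C", OF _ this] show ?thesis using C(1) by simp
qed

text \<open>
  By \<open>exp (W (y, x)) - exp (W (y, x')) = exp (W (y, x')) * (exp (W (y, x) - W (y, x')) - 1)\<close> the
  estimate passes from \<open>W\<close> to the functions on which the distributions are evaluated.
\<close>

lemma exp_kernel_section_lipschitz:
  obtains K where "\<And>n x x'. stake n x = stake n x' \<Longrightarrow>
    holder_bound \<theta> (K * \<theta> ^ n) (\<lambda>y. exp (W (y, x)) - exp (W (y, x')))"
proof -
  obtain K where K: "0 \<le> K" "\<And>n x x'. stake n x = stake n x' \<Longrightarrow>
      holder_bound \<theta> (K * \<theta> ^ n) (\<lambda>y. W (y, x) - W (y, x'))"
    by (rule kernel_section_lipschitz) (rule that)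
  obtain E where E: "\<And>x. holder_bound \<theta> E (\<lambda>y. exp (W (y, x)))"
    "\<And>x. holder_bound \<theta> E (\<lambda>y. exp (- W (y, x)))"
    "\<And>y. holder_bound \<theta> E (\<lambda>x. exp (- W (y, x)))"
    by (rule exp_kernel_sections_bound) (rule that)
  have E0: "0 \<le> E" by (rule holder_bound_nonneg[OF E(1)])
  have "holder_bound \<theta> (2 * E * (exp K * K) * \<theta> ^ n) (\<lambda>y. exp (W (y, x)) - exp (W (y, x')))"
    if e: "stake n x = stake n x'" for n x x'
  proof -
    let ?k = "K * \<theta> ^ n"
    have "holder_bound \<theta> (2 * E * (exp ?k * ?k)) (\<lambda>y. exp (W (y, x')) * (exp (W (y, x) - W (y, x')) - 1))"
      by (intro holder_bound_mult E(1) holder_bound_exp_minus_1 K(2)[OF e])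
    then have "holder_bound \<theta> (2 * E * (exp ?k * ?k)) (\<lambda>y. exp (W (y, x)) - exp (W (y, x')))"
      by (simp add: right_diff_distrib flip: exp_add)
    moreover have "exp ?k \<le> exp K" using K(1) theta_pow[of n] by (simp add: mult_left_le)
    then have "2 * E * (exp ?k * ?k) \<le> 2 * E * (exp K * ?k)"
      using E0 K(1) theta_pow[of n] by (intro mult_left_mono mult_right_mono) auto
    ultimately show ?thesis by (simp add: holder_bound_mono mult.assoc)
  qed
  then show ?thesis by (rule that)
qed

section \<open>From eigendistributions to eigenfunctions\<close>

text \<open>
  Images of arbitrary continuous functionals, not only of eigendistributions, are Hoelder and in
  particular continuous.
\<close>

lemma kernel_map_Holder:
  assumes D: "D \<in> Holder_dual \<theta>"
  shows "kernel_map W D \<in> Holder \<theta>"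
proof -
  obtain C where C: "0 \<le> C" "\<And>K f. holder_bound \<theta> K f \<Longrightarrow> cmod (D f) \<le> C * K"
    by (rule Holder_dual_bound[OF D]) (rule that)
  obtain K where K: "\<And>n x x'. stake n x = stake n x' \<Longrightarrow>
    holder_bound \<theta> (K * \<theta> ^ n) (\<lambda>y. exp (W (y, x)) - exp (W (y, x')))"
    by (rule exp_kernel_section_lipschitz) (rule that)
  have K0: "0 \<le> K" using holder_bound_nonneg[OF K[of 0]] by simp
  have "cmod (kernel_map W D x - kernel_map W D x') \<le> C * K * \<theta> ^ n"
    if "stake n x = stake n x'" for n x x'
    using C(2)[OF K[OF that]] Holder_dual_diff[OF D exp_kernel_Holder exp_kernel_Holder]
    by (simp add: kernel_map_def mult.assoc)
  then show ?thesis unfolding Holder_def using C(1) K0 by (auto intro!: exI[of _ "C * K"])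
qed

lemma kernel_map_bounded:
  "bounded_linear_on_funs (Holder_dual \<theta>) (dual_norm \<theta>) Cont sup_norm (kernel_map W)"
proof -
  obtain K where K: "\<And>x. holder_bound \<theta> K (\<lambda>y. exp (W (y, x)))"
    "\<And>x. holder_bound \<theta> K (\<lambda>y. exp (- W (y, x)))"
    "\<And>y. holder_bound \<theta> K (\<lambda>x. exp (- W (y, x)))"
    by (rule exp_kernel_sections_bound) (rule that)
  have "sup_norm (kernel_map W D) \<le> 2 * K * dual_norm \<theta> D" if D: "D \<in> Holder_dual \<theta>" for D
  proof -
    have "0 \<le> dual_norm \<theta> D * holder_norm \<theta> (\<lambda>_ :: 'm stream. 1)"
      using dual_norm_upper[OF D Holder_const[of 1]] norm_ge_zero order_trans by blast
    moreover have "holder_bound \<theta> (2 * holder_norm \<theta> (\<lambda>_ :: 'm stream. 1)) (\<lambda>_ :: 'm stream. 1)"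
      by (rule holder_bound_holder_norm[OF Holder_const])
    then have "0 < holder_norm \<theta> (\<lambda>_ :: 'm stream. 1)" by (auto dest: holder_bound_norm)
    ultimately have D0: "0 \<le> dual_norm \<theta> D" by (simp add: zero_le_mult_iff)
    have "cmod (kernel_map W D x) \<le> dual_norm \<theta> D * (2 * K)" for x
      using dual_norm_upper[OF D exp_kernel_Holder, of x] mult_left_mono[OF holder_norm_le[OF K(1)[of x]] D0]
      by (simp add: kernel_map_def)
    then show ?thesis unfolding sup_norm_def by (intro cSUP_least) (auto simp: mult.commute)
  qed
  moreover have "kernel_map W ` Holder_dual \<theta> \<subseteq> Cont"
    using kernel_map_Holder Holder_subset_Cont by blast
  moreover have "linear_on_funs (Holder_dual \<theta>) (kernel_map W)"
    by (simp add: linear_on_funs_def kernel_map_def fun_eq_iff)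
  ultimately show ?thesis unfolding bounded_linear_on_funs_def by blast
qed

text \<open>
  The intertwining relation: applied to \<open>exp W\<close>, the Ruelle operator of \<open>Astar\<close> in the variable \<open>y\<close>
  equals the one of \<open>A\<close> in the variable \<open>x\<close>.
\<close>

lemma ruelle_exp_kernel:
  "ruelle a Astar (\<lambda>y. exp (W (y, x))) y = integ a (\<lambda>j. exp (A (j ## x)) * exp (W (y, j ## x)))"
  by (simp add: ruelle_def kernel_Cons flip: exp_add)

lemma kernel_map_eigenfunction:
  assumes "D \<in> eigendistributions \<theta> a Astar l"
  shows "kernel_map W D \<in> eigenfunctions \<theta> a A l"
proof -
  have D: "D \<in> Holder_dual \<theta>" and eig: "\<And>\<phi>. \<phi> \<in> Holder \<theta> \<Longrightarrow> D (ruelle a Astar \<phi>) = l * D \<phi>"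
    using assms by (auto simp: eigendistributions_def)
  have "ruelle a A (kernel_map W D) x = l * kernel_map W D x" for x
  proof -
    have "ruelle a A (kernel_map W D) x
        = integ a (\<lambda>j. D (\<lambda>y. exp (A (j ## x)) * exp (W (y, j ## x))))"
      unfolding ruelle_def kernel_map_def Holder_dual_cmult[OF D exp_kernel_Holder] ..
    also have "\<dots> = D (\<lambda>y. integ a (\<lambda>j. exp (A (j ## x)) * exp (W (y, j ## x))))"
      by (rule Holder_dual_integ[OF D, symmetric]) (rule Holder_cmult[OF exp_kernel_Holder])
    also have "\<dots> = l * kernel_map W D x"
      using eig[OF exp_kernel_Holder[of x]] by (simp add: ruelle_exp_kernel[abs_def] kernel_map_def)
    finally show ?thesis .
  qed
  then show ?thesis using kernel_map_Holder[OF D] by (simp add: eigenfunctions_def fun_eq_iff)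
qed

end

section \<open>Recovering the distribution\<close>

locale involution_eigenvalue =
  involution \<theta> a A Astar W + transfer_eigenvalue \<theta> a A l
  for \<theta> and a :: "'m::finite \<Rightarrow> real" and A Astar :: "'m stream \<Rightarrow> complex"
    and W :: "'m stream \<times> 'm stream \<Rightarrow> complex" and l :: complex
begin

lemma inverse_seq_eq:
  "inverse_seq a A W l \<psi> x z \<phi> n = iter_integ a n (\<lambda>w. exp (birkhoff_sum A n (rev w @- x)) *
     (\<psi> (rev w @- x) * (exp (- W (w @- sconst z, x)) * \<phi> (w @- sconst z)))) / l ^ n"
  unfolding inverse_seq_def divide_inverse mult.commute[of _ "inverse (l ^ n)"] iter_integ_cmult[symmetric]
  by (simp add: ac_simps)

text \<open>
  The same measures written with the weights of \<open>Astar\<close>. Here the base point \<open>x\<close> occurs only behind the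
  word \<open>rev w\<close>, so that changing it, or inserting a symbol before it, is a small perturbation.
\<close>

lemma inverse_seq_eq_dual:
  "inverse_seq a A W l \<psi> x z \<phi> n = iter_integ a n (\<lambda>w. exp (birkhoff_sum Astar n (w @- sconst z)) *
     (\<psi> (rev w @- x) * exp (- W (sconst z, rev w @- x)) * \<phi> (w @- sconst z))) / l ^ n"
proof -
  have eq: "exp (birkhoff_sum A n (rev w @- x)) *
        (\<psi> (rev w @- x) * (exp (- W (w @- sconst z, x)) * \<phi> (w @- sconst z)))
      = exp (birkhoff_sum Astar n (w @- sconst z)) *
        (\<psi> (rev w @- x) * exp (- W (sconst z, rev w @- x)) * \<phi> (w @- sconst z))"
    if "length w = n" for w
  proof -
    have "exp (W (sconst z, rev w @- x)) * exp (- W (sconst z, rev w @- x)) = 1"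
      by (simp flip: exp_add)
    then show ?thesis unfolding dual_weight_eq[OF that, of _ x] by algebra
  qed
  show ?thesis
    unfolding inverse_seq_eq by (rule arg_cong[where f = "\<lambda>u. u / l ^ n", OF iter_integ_cong]) (rule eq)
qed

lemma dual_weight_bound:
  obtains B where "0 \<le> B" "\<And>n w x y. length w = n \<Longrightarrow>
    cmod (exp (birkhoff_sum Astar n (w @- y))) \<le> B * exp (Re (birkhoff_sum A n (rev w @- x)))"
proof -
  obtain E where E: "\<And>x. holder_bound \<theta> E (\<lambda>y. exp (W (y, x)))"
    "\<And>x. holder_bound \<theta> E (\<lambda>y. exp (- W (y, x)))"
    "\<And>y. holder_bound \<theta> E (\<lambda>x. exp (- W (y, x)))"
    by (rule exp_kernel_sections_bound) (rule that)
  have E0: "0 \<le> E" by (rule holder_bound_nonneg[OF E(1)])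
  have "cmod (exp (birkhoff_sum Astar n (w @- y))) \<le> (E * E) * exp (Re (birkhoff_sum A n (rev w @- x)))"
    if "length w = n" for n w x y
  proof -
    have "cmod (exp (W (y, rev w @- x))) * cmod (exp (- W (w @- y, x))) \<le> E * E"
      using E0 by (intro mult_mono holder_bound_norm[OF E(1)] holder_bound_norm[OF E(2)]) auto
    then have "exp (Re (birkhoff_sum A n (rev w @- x))) *
        (cmod (exp (W (y, rev w @- x))) * cmod (exp (- W (w @- y, x))))
        \<le> exp (Re (birkhoff_sum A n (rev w @- x))) * (E * E)"
      by (rule mult_left_mono) simp
    then show ?thesis
      unfolding dual_weight_eq[OF that, of y x] by (simp add: norm_mult mult.commute)
  qed
  then show ?thesis by (rule that[OF mult_nonneg_nonneg[OF E0 E0]])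
qed

section \<open>Uniqueness\<close>

lemma eigendistribution_funpow:
  assumes "D \<in> eigendistributions \<theta> a Astar l" "\<phi> \<in> Holder \<theta>"
  shows "D ((ruelle a Astar ^^ n) \<phi>) = l ^ n * D \<phi>"
  using assms(2)
proof (induction n arbitrary: \<phi>)
  case (Suc n)
  have "D ((ruelle a Astar ^^ Suc n) \<phi>) = D ((ruelle a Astar ^^ n) (ruelle a Astar \<phi>))"
    by (simp add: funpow_swap1)
  also have "\<dots> = l ^ n * D (ruelle a Astar \<phi>)"
    by (rule Suc.IH) (rule Holder_ruelle[OF Astar_Holder Suc.prems])
  also have "\<dots> = l ^ Suc n * D \<phi>"
    using assms(1) Suc.prems by (simp add: eigendistributions_def)
  finally show ?case .
qed simp

text \<open>
  An eigendistribution satisfies \<open>D \<phi> = D ((ruelle a Astar ^^ n) \<phi>) / l ^ n\<close>. With the weights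
  rewritten by \<open>dual_weight_eq\<close>, the \<open>w\<close>-th summand is \<open>D\<close> applied to \<open>exp W\<close> times \<open>h (w @- y)\<close>, where
  \<open>h y = exp (- W (y, x)) * \<phi> y\<close>. Replacing \<open>h (w @- y)\<close> by the constant \<open>h (w @- sconst z)\<close> turns it
  into a value of the kernel map, which is the summand of the inverse formula, and the error is
  of order \<open>\<theta> ^ n\<close> in the Hoelder norm. Thus \<open>D\<close> is determined by its image.
\<close>

lemma eigendistribution_eq_limit:
  assumes eig: "D \<in> eigendistributions \<theta> a Astar l" and \<phi>: "\<phi> \<in> Holder \<theta>"
  shows "inverse_seq a A W l (kernel_map W D) x z \<phi> \<longlonglongrightarrow> D \<phi>"
proof -
  have D: "D \<in> Holder_dual \<theta>" using eig by (simp add: eigendistributions_def)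
  obtain C where C: "0 \<le> C" "\<And>K f. holder_bound \<theta> K f \<Longrightarrow> cmod (D f) \<le> C * K"
    by (rule Holder_dual_bound[OF D]) (rule that)
  obtain E where E: "\<And>x. holder_bound \<theta> E (\<lambda>y. exp (W (y, x)))"
    "\<And>x. holder_bound \<theta> E (\<lambda>y. exp (- W (y, x)))"
    "\<And>y. holder_bound \<theta> E (\<lambda>x. exp (- W (y, x)))"
    by (rule exp_kernel_sections_bound) (rule that)
  have E0: "0 \<le> E" by (rule holder_bound_nonneg[OF E(1)])
  obtain P where P: "holder_bound \<theta> P \<phi>" using \<phi> Holder_iff_holder_bound by blast
  define h where "h = (\<lambda>y. exp (- W (y, x)) * \<phi> y)"
  define H where "H = 2 * E * P"
  have h: "holder_bound \<theta> H h" unfolding h_def H_def by (intro holder_bound_mult E(2) P)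
  have H0: "0 \<le> H" by (rule holder_bound_nonneg[OF h])
  define c where "c = (\<lambda>n w. exp (birkhoff_sum A n (rev w @- x)))"
  define e where "e = (\<lambda>w y. exp (W (y, rev w @- x)))"
  have eH: "e w \<in> Holder \<theta>" for w unfolding e_def by (rule exp_kernel_Holder)
  have ehH: "(\<lambda>y. e w y * h (w @- y)) \<in> Holder \<theta>" for w
    by (intro Holder_mult[OF eH] Holder_shift holder_bound_imp_Holder[OF h])
  define R where "R = (\<lambda>n. iter_integ a n (\<lambda>w. c n w * D (\<lambda>y. e w y * (h (w @- y) - h (w @- sconst z)))))"
  have difference: "D \<phi> - inverse_seq a A W l (kernel_map W D) x z \<phi> n = R n / l ^ n" for n
  proof -
    have "(ruelle a Astar ^^ n) \<phi> = (\<lambda>y. iter_integ a n (\<lambda>w. c n w * (e w y * h (w @- y))))"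
    proof
      fix y
      have "exp (birkhoff_sum Astar n (w @- y)) * \<phi> (w @- y) = c n w * (e w y * h (w @- y))"
        if "length w = n" for w
        unfolding dual_weight_eq[OF that, of y x] by (simp add: c_def e_def h_def)
      then show "(ruelle a Astar ^^ n) \<phi> y = iter_integ a n (\<lambda>w. c n w * (e w y * h (w @- y)))"
        unfolding ruelle_funpow by (rule iter_integ_cong)
    qed
    then have "l ^ n * D \<phi> = D (\<lambda>y. iter_integ a n (\<lambda>w. c n w * (e w y * h (w @- y))))"
      using eigendistribution_funpow[OF eig \<phi>, of n] by simp
    also have "\<dots> = iter_integ a n (\<lambda>w. D (\<lambda>y. c n w * (e w y * h (w @- y))))"
      by (intro Holder_dual_iter_integ[OF D] Holder_cmult ehH)
    also have "\<dots> = iter_integ a n (\<lambda>w. c n w * D (\<lambda>y. e w y * h (w @- y)))"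
      by (simp only: Holder_dual_cmult[OF D ehH])
    finally have main: "D \<phi> = iter_integ a n (\<lambda>w. c n w * D (\<lambda>y. e w y * h (w @- y))) / l ^ n"
      using l_nonzero by (simp add: field_simps)
    have "D (\<lambda>y. e w y * (h (w @- y) - h (w @- sconst z)))
        = D (\<lambda>y. e w y * h (w @- y)) - D (e w) * h (w @- sconst z)" for w
      using Holder_dual_diff[OF D ehH[of w] Holder_cmult[OF eH[of w], of "h (w @- sconst z)"]]
        Holder_dual_cmult[OF D eH[of w], of "h (w @- sconst z)"]
      by (simp add: right_diff_distrib mult.commute)
    then have "R n = iter_integ a n (\<lambda>w. c n w * D (\<lambda>y. e w y * h (w @- y)))
        - iter_integ a n (\<lambda>w. c n w * (D (e w) * h (w @- sconst z)))"
      by (simp add: R_def right_diff_distrib iter_integ_diff)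
    moreover have "inverse_seq a A W l (kernel_map W D) x z \<phi> n
        = iter_integ a n (\<lambda>w. c n w * (D (e w) * h (w @- sconst z))) / l ^ n"
      by (simp add: inverse_seq_eq c_def e_def h_def kernel_map_def)
    ultimately show ?thesis by (simp add: main diff_divide_distrib)
  qed
  have "cmod (R n / l ^ n) \<le> (C * (2 * E * H)) * decay n" for n
    unfolding R_def
  proof (rule integral_le_decay)
    show "0 \<le> C * (2 * E * H)" using C(1) E0 H0 by simp
    fix w :: "'m list" assume w: "length w = n"
    have "holder_bound \<theta> (2 * E * (H * \<theta> ^ length w)) (\<lambda>y. e w y * (h (w @- y) - h (w @- sconst z)))"
      unfolding e_def by (intro holder_bound_mult E(1) holder_bound_shift_diff h)
    then have "cmod (D (\<lambda>y. e w y * (h (w @- y) - h (w @- sconst z)))) \<le> C * (2 * E * (H * \<theta> ^ n))"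
      using C(2) w by blast
    then have "cmod (c n w) * cmod (D (\<lambda>y. e w y * (h (w @- y) - h (w @- sconst z))))
        \<le> cmod (c n w) * (C * (2 * E * (H * \<theta> ^ n)))"
      by (rule mult_left_mono) simp
    then show "cmod (c n w * D (\<lambda>y. e w y * (h (w @- y) - h (w @- sconst z))))
        \<le> C * (2 * E * H) * \<theta> ^ n * exp (Re (birkhoff_sum A n (rev w @- x)))"
      by (simp add: norm_mult c_def ac_simps)
  qed
  then have "(\<lambda>n. D \<phi> - inverse_seq a A W l (kernel_map W D) x z \<phi> n) \<longlonglongrightarrow> 0"
    unfolding difference by (rule tendsto_0_if_le_decay)
  then have "(\<lambda>n. D \<phi> - (D \<phi> - inverse_seq a A W l (kernel_map W D) x z \<phi> n)) \<longlonglongrightarrow> D \<phi> - 0"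
    by (intro tendsto_intros)
  then show ?thesis by simp
qed

lemma kernel_map_inj_on: "inj_on (kernel_map W) (eigendistributions \<theta> a Astar l)"
proof (rule inj_onI, rule ext)
  fix D D' \<phi>
  assume D: "D \<in> eigendistributions \<theta> a Astar l" and D': "D' \<in> eigendistributions \<theta> a Astar l"
    and eq: "kernel_map W D = kernel_map W D'"
  show "D \<phi> = D' \<phi>"
  proof (cases "\<phi> \<in> Holder \<theta>")
    case True
    show ?thesis
      using eigendistribution_eq_limit[OF D True, of undefined undefined]
        eigendistribution_eq_limit[OF D' True, of undefined undefined]
      unfolding eq by (rule LIMSEQ_unique)
  next
    case False
    then show ?thesis using D D' by (simp add: eigendistributions_def Holder_dual_def)
  qed
qed

section \<open>Existence\<close>

text \<open>
  Expanding the eigenvalue equation for \<open>\<psi>\<close> once turns the \<open>n\<close>-th term into an integral over words of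
  length \<open>n + 1\<close> in which the last symbol is dropped from the argument of \<open>h\<close>. It then differs from the
  next term only by an oscillation of \<open>h\<close> over points that agree on \<open>n\<close> symbols. The constant \<open>M\<close> is
  independent of \<open>\<phi>\<close>, as continuity of the limit functional requires.
\<close>

lemma inverse_seq_increment:
  assumes \<psi>: "\<psi> \<in> eigenfunctions \<theta> a A l"
  obtains M where "0 \<le> M"
    "\<And>P \<phi>. holder_bound \<theta> P \<phi> \<Longrightarrow> cmod (inverse_seq a A W l \<psi> x z \<phi> 0) \<le> M * P"
    "\<And>P \<phi> n. holder_bound \<theta> P \<phi> \<Longrightarrow>
       cmod (inverse_seq a A W l \<psi> x z \<phi> (Suc n) - inverse_seq a A W l \<psi> x z \<phi> n) \<le> M * P * decay (Suc n)"
proof -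
  have eig: "integ a (\<lambda>j. exp (A (j ## u)) * \<psi> (j ## u)) = l * \<psi> u" for u
    using \<psi> by (simp add: eigenfunctions_def ruelle_def fun_eq_iff)
  obtain Q where Q: "holder_bound \<theta> Q \<psi>"
    using \<psi> Holder_iff_holder_bound by (auto simp: eigenfunctions_def)
  have Q0: "0 \<le> Q" by (rule holder_bound_nonneg[OF Q])
  obtain E where E: "\<And>x. holder_bound \<theta> E (\<lambda>y. exp (W (y, x)))"
    "\<And>x. holder_bound \<theta> E (\<lambda>y. exp (- W (y, x)))"
    "\<And>y. holder_bound \<theta> E (\<lambda>x. exp (- W (y, x)))"
    by (rule exp_kernel_sections_bound) (rule that)
  have E0: "0 \<le> E" by (rule holder_bound_nonneg[OF E(1)])
  (* The division by \<theta> is due to the integral over n + 1 symbols, while the agreement is on n only. *)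
  define M where "M = Q * (2 * E) / \<theta>"
  have M0: "0 \<le> M" using Q0 E0 theta_pos by (simp add: M_def)
  have QM: "Q * (2 * E) \<le> M"
    using Q0 E0 theta_pos theta_less_1 by (simp add: M_def le_divide_eq mult_left_le)
  have inc_0: "cmod (inverse_seq a A W l \<psi> x z \<phi> 0) \<le> M * P" and
    inc_Suc: "cmod (inverse_seq a A W l \<psi> x z \<phi> (Suc n) - inverse_seq a A W l \<psi> x z \<phi> n) \<le> M * P * decay (Suc n)"
    if P: "holder_bound \<theta> P \<phi>" for P \<phi> n
  proof -
    define h where "h = (\<lambda>y. exp (- W (y, x)) * \<phi> y)"
    define H where "H = 2 * E * P"
    have h: "holder_bound \<theta> H h" unfolding h_def H_def by (intro holder_bound_mult E(2) P)
    have P0: "0 \<le> P" by (rule holder_bound_nonneg[OF P])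
    have "cmod (\<psi> x * h (sconst z)) \<le> Q * H"
      unfolding norm_mult using Q0
      by (intro mult_mono holder_bound_norm[OF Q] holder_bound_norm[OF h]) auto
    also have "\<dots> \<le> M * P" using mult_right_mono[OF QM P0] by (simp add: H_def mult.assoc)
    finally show "cmod (inverse_seq a A W l \<psi> x z \<phi> 0) \<le> M * P" by (simp add: inverse_seq_eq h_def)

    define c where "c = (\<lambda>w. exp (birkhoff_sum A (Suc n) (rev w @- x)))"
    have "inverse_seq a A W l \<psi> x z \<phi> n
        = iter_integ a n (\<lambda>w. exp (birkhoff_sum A n (rev w @- x)) * (\<psi> (rev w @- x) * h (w @- sconst z))) / l ^ n"
      by (simp add: inverse_seq_eq h_def)
    also have "\<dots> = iter_integ a n (\<lambda>w. l * (exp (birkhoff_sum A n (rev w @- x)) *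
        (\<psi> (rev w @- x) * h (w @- sconst z)))) / l ^ Suc n"
      unfolding iter_integ_cmult using l_nonzero by simp
    also have "iter_integ a n (\<lambda>w. l * (exp (birkhoff_sum A n (rev w @- x)) *
          (\<psi> (rev w @- x) * h (w @- sconst z))))
        = iter_integ a n (\<lambda>w. integ a (\<lambda>j. c (w @ [j]) *
          (\<psi> (rev (w @ [j]) @- x) * h (butlast (w @ [j]) @- sconst z))))"
    proof (rule iter_integ_cong)
      fix w :: "'m list" assume "length w = n"
      let ?u = "rev w @- x"
      have "l * (exp (birkhoff_sum A n ?u) * (\<psi> ?u * h (w @- sconst z)))
          = (exp (birkhoff_sum A n ?u) * h (w @- sconst z)) * (l * \<psi> ?u)" by simp
      also have "\<dots> = integ a (\<lambda>j. (exp (birkhoff_sum A n ?u) * h (w @- sconst z)) *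
          (exp (A (j ## ?u)) * \<psi> (j ## ?u)))"
        unfolding integ_cmult eig ..
      also have "\<dots> = integ a (\<lambda>j. c (w @ [j]) * (\<psi> (rev (w @ [j]) @- x) * h (butlast (w @ [j]) @- sconst z)))"
        by (simp add: c_def birkhoff_sum_Cons exp_add ac_simps)
      finally show "l * (exp (birkhoff_sum A n ?u) * (\<psi> ?u * h (w @- sconst z))) = \<dots>" .
    qed
    also have "\<dots> = iter_integ a (Suc n) (\<lambda>w. c w * (\<psi> (rev w @- x) * h (butlast w @- sconst z)))"
      by (rule iter_integ_Suc_snoc[symmetric])
    finally have "inverse_seq a A W l \<psi> x z \<phi> (Suc n) - inverse_seq a A W l \<psi> x z \<phi> n
        = iter_integ a (Suc n) (\<lambda>w. c w * (\<psi> (rev w @- x) * (h (w @- sconst z) - h (butlast w @- sconst z))))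
          / l ^ Suc n"
      by (simp only: inverse_seq_eq[of \<psi> x z \<phi> "Suc n"] c_def h_def iter_integ_diff[symmetric]
          diff_divide_distrib[symmetric] right_diff_distrib)
    also have "cmod \<dots> \<le> M * P * decay (Suc n)"
    proof (rule integral_le_decay)
      show "0 \<le> M * P" using M0 P0 by simp
      fix w :: "'m list" assume w: "length w = Suc n"
      have "stake n (w @- sconst z) = stake n (butlast w @- sconst z)"
        using w by (simp add: stake_shift butlast_conv_take)
      then have "cmod (\<psi> (rev w @- x)) * cmod (h (w @- sconst z) - h (butlast w @- sconst z)) \<le> Q * (H * \<theta> ^ n)"
        using Q0 by (intro mult_mono holder_bound_norm[OF Q] holder_bound_diff[OF h]) auto
      also have "\<dots> = M * P * \<theta> ^ Suc n" using theta_pos by (simp add: M_def H_def)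
      finally have "cmod (c w) * (cmod (\<psi> (rev w @- x)) * cmod (h (w @- sconst z) - h (butlast w @- sconst z)))
          \<le> cmod (c w) * (M * P * \<theta> ^ Suc n)"
        by (rule mult_left_mono) simp
      then show "cmod (c w * (\<psi> (rev w @- x) * (h (w @- sconst z) - h (butlast w @- sconst z))))
          \<le> M * P * \<theta> ^ Suc n * exp (Re (birkhoff_sum A (Suc n) (rev w @- x)))"
        by (simp add: norm_mult c_def mult.commute)
    qed
    finally show "cmod (inverse_seq a A W l \<psi> x z \<phi> (Suc n) - inverse_seq a A W l \<psi> x z \<phi> n)
      \<le> M * P * decay (Suc n)" .
  qed
  show ?thesis by (rule that[OF M0 inc_0 inc_Suc])
qed

lemma inverse_seq_convergent:
  assumes \<psi>: "\<psi> \<in> eigenfunctions \<theta> a A l" and \<phi>: "\<phi> \<in> Holder \<theta>"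
  shows "convergent (inverse_seq a A W l \<psi> x z \<phi>)"
proof -
  obtain P where P: "holder_bound \<theta> P \<phi>" using \<phi> Holder_iff_holder_bound by blast
  obtain M where M: "0 \<le> M"
    "\<And>P \<phi>. holder_bound \<theta> P \<phi> \<Longrightarrow> cmod (inverse_seq a A W l \<psi> x z \<phi> 0) \<le> M * P"
    "\<And>P \<phi> n. holder_bound \<theta> P \<phi> \<Longrightarrow>
       cmod (inverse_seq a A W l \<psi> x z \<phi> (Suc n) - inverse_seq a A W l \<psi> x z \<phi> n) \<le> M * P * decay (Suc n)"
    by (rule inverse_seq_increment[OF \<psi>]) (rule that)
  from M(3)[OF P] show ?thesis
    by (rule convergent_if_increments_summable(1))
       (use summable_decay in \<open>simp add: summable_mult summable_Suc_iff\<close>)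
qed

lemma inverse_functional_tendsto:
  assumes "\<psi> \<in> eigenfunctions \<theta> a A l" "\<phi> \<in> Holder \<theta>"
  shows "inverse_seq a A W l \<psi> x z \<phi> \<longlonglongrightarrow> inverse_functional \<theta> a A W l \<psi> x z \<phi>"
  using inverse_seq_convergent[OF assms] assms(2)
  by (simp add: inverse_functional_def convergent_LIMSEQ_iff)

lemma inverse_functional_in_dual:
  assumes \<psi>: "\<psi> \<in> eigenfunctions \<theta> a A l"
  shows "inverse_functional \<theta> a A W l \<psi> x z \<in> Holder_dual \<theta>"
proof -
  let ?I = "inverse_seq a A W l \<psi> x z" and ?F = "inverse_functional \<theta> a A W l \<psi> x z"
  note lim = inverse_functional_tendsto[OF \<psi>, of _ x z]
  have add: "?F (\<lambda>y. \<phi> y + \<phi>' y) = ?F \<phi> + ?F \<phi>'" if \<phi>: "\<phi> \<in> Holder \<theta>" "\<phi>' \<in> Holder \<theta>" for \<phi> \<phi>'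
  proof (rule LIMSEQ_unique[OF lim[OF Holder_add[OF \<phi>]]])
    have "?I (\<lambda>y. \<phi> y + \<phi>' y) = (\<lambda>n. ?I \<phi> n + ?I \<phi>' n)"
      by (simp add: inverse_seq_def fun_eq_iff distrib_left iter_integ_add)
    then show "?I (\<lambda>y. \<phi> y + \<phi>' y) \<longlonglongrightarrow> ?F \<phi> + ?F \<phi>'"
      using tendsto_add[OF lim[OF \<phi>(1)] lim[OF \<phi>(2)]] by simp
  qed
  have cmult: "?F (\<lambda>y. c * \<phi> y) = c * ?F \<phi>" if \<phi>: "\<phi> \<in> Holder \<theta>" for c \<phi>
  proof (rule LIMSEQ_unique[OF lim[OF Holder_cmult[OF \<phi>]]])
    have "?I (\<lambda>y. c * \<phi> y) = (\<lambda>n. c * ?I \<phi> n)"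
      by (simp add: inverse_seq_def fun_eq_iff mult.left_commute[of _ c] flip: iter_integ_cmult)
    then show "?I (\<lambda>y. c * \<phi> y) \<longlonglongrightarrow> c * ?F \<phi>"
      using tendsto_mult_left[OF lim[OF \<phi>], of c] by simp
  qed
  obtain M where M: "0 \<le> M"
    "\<And>P \<phi>. holder_bound \<theta> P \<phi> \<Longrightarrow> cmod (?I \<phi> 0) \<le> M * P"
    "\<And>P \<phi> n. holder_bound \<theta> P \<phi> \<Longrightarrow> cmod (?I \<phi> (Suc n) - ?I \<phi> n) \<le> M * P * decay (Suc n)"
    by (rule inverse_seq_increment[OF \<psi>]) (rule that)
  define T where "T = (\<Sum>n. decay (Suc n))"
  have s: "summable (\<lambda>n. decay (Suc n))" using summable_decay by (simp add: summable_Suc_iff)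
  have "cmod (?F \<phi>) \<le> (2 * M * (1 + T)) * holder_norm \<theta> \<phi>" if \<phi>: "\<phi> \<in> Holder \<theta>" for \<phi>
  proof -
    let ?P = "2 * holder_norm \<theta> \<phi>"
    have P: "holder_bound \<theta> ?P \<phi>" by (rule holder_bound_holder_norm[OF \<phi>])
    have "cmod (lim (?I \<phi>)) \<le> cmod (?I \<phi> 0) + (\<Sum>n. M * ?P * decay (Suc n))"
      by (rule convergent_if_increments_summable(2)[where f = "?I \<phi>", OF M(3)[OF P]]) (rule summable_mult[OF s])
    also have "\<dots> \<le> M * ?P + M * ?P * T"
      using M(2)[OF P] suminf_mult[OF s, of "M * ?P"] by (simp add: T_def)
    finally show ?thesis using \<phi> by (simp add: inverse_functional_def algebra_simps)
  qed
  with add cmult show ?thesis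
    unfolding Holder_dual_def
    by (intro CollectI conjI ballI allI impI exI[of _ "2 * M * (1 + T)"]) (simp_all add: inverse_functional_def)
qed

lemma normalized_eigenfunction_bound:
  assumes "\<psi> \<in> eigenfunctions \<theta> a A l"
  obtains G where "0 \<le> G" "holder_bound \<theta> G (\<lambda>x. \<psi> x * exp (- W (y, x)))"
proof -
  have "\<psi> \<in> Holder \<theta>" using assms by (simp add: eigenfunctions_def)
  moreover obtain E where E: "\<And>x. holder_bound \<theta> E (\<lambda>y. exp (W (y, x)))"
    "\<And>x. holder_bound \<theta> E (\<lambda>y. exp (- W (y, x)))"
    "\<And>y. holder_bound \<theta> E (\<lambda>x. exp (- W (y, x)))"
    by (rule exp_kernel_sections_bound) (rule that)
  have "(\<lambda>x. exp (- W (y, x))) \<in> Holder \<theta>" by (rule holder_bound_imp_Holder[OF E(3)])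
  ultimately have "(\<lambda>x. \<psi> x * exp (- W (y, x))) \<in> Holder \<theta>" by (rule Holder_mult)
  then obtain G where G: "holder_bound \<theta> G (\<lambda>x. \<psi> x * exp (- W (y, x)))"
    unfolding Holder_iff_holder_bound ..
  show ?thesis by (rule that[OF holder_bound_nonneg[OF G] G])
qed

text \<open>
  In the dual form the two integrands differ by an oscillation of \<open>\<psi> * exp (- W (sconst z, \<cdot>))\<close> over
  points that share the prefix \<open>rev w\<close>.
\<close>

lemma inverse_functional_base_point:
  assumes \<psi>: "\<psi> \<in> eigenfunctions \<theta> a A l"
  shows "inverse_functional \<theta> a A W l \<psi> x z = inverse_functional \<theta> a A W l \<psi> x' z"
proof
  fix \<phi>
  show "inverse_functional \<theta> a A W l \<psi> x z \<phi> = inverse_functional \<theta> a A W l \<psi> x' z \<phi>"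
  proof (cases "\<phi> \<in> Holder \<theta>")
    case False
    then show ?thesis by (simp add: inverse_functional_def)
  next
    case \<phi>: True
    obtain P where P: "holder_bound \<theta> P \<phi>" using \<phi> Holder_iff_holder_bound by blast
    have P0: "0 \<le> P" by (rule holder_bound_nonneg[OF P])
    define g where "g = (\<lambda>x. \<psi> x * exp (- W (sconst z, x)))"
    obtain G where "0 \<le> G" "holder_bound \<theta> G (\<lambda>x. \<psi> x * exp (- W (sconst z, x)))"
      by (rule normalized_eigenfunction_bound[OF \<psi>]) (rule that)
    note G = this[folded g_def]
    obtain B where B: "0 \<le> B" "\<And>n w x y. length w = n \<Longrightarrow>
      cmod (exp (birkhoff_sum Astar n (w @- y))) \<le> B * exp (Re (birkhoff_sum A n (rev w @- x)))"
      by (rule dual_weight_bound) (rule that)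
    have "cmod (inverse_seq a A W l \<psi> x z \<phi> n - inverse_seq a A W l \<psi> x' z \<phi> n) \<le> (B * (G * P)) * decay n" for n
    proof -
      have "inverse_seq a A W l \<psi> x z \<phi> n - inverse_seq a A W l \<psi> x' z \<phi> n
          = iter_integ a n (\<lambda>w. exp (birkhoff_sum Astar n (w @- sconst z)) *
              ((g (rev w @- x) - g (rev w @- x')) * \<phi> (w @- sconst z))) / l ^ n"
        by (simp add: inverse_seq_eq_dual g_def left_diff_distrib right_diff_distrib
            iter_integ_diff diff_divide_distrib)
      also have "cmod \<dots> \<le> (B * (G * P)) * decay n"
      proof (rule integral_le_decay)
        show "0 \<le> B * (G * P)" using B(1) G(1) P0 by simp
        fix w :: "'m list" assume w: "length w = n"
        have "stake n (rev w @- x) = stake n (rev w @- x')" using w by (simp add: stake_shift)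
        then have "cmod (exp (birkhoff_sum Astar n (w @- sconst z))) *
            (cmod (g (rev w @- x) - g (rev w @- x')) * cmod (\<phi> (w @- sconst z)))
            \<le> (B * exp (Re (birkhoff_sum A n (rev w @- x)))) * ((G * \<theta> ^ n) * P)"
          using B(1) G(1) theta_pow[of n]
          by (intro mult_mono B(2) w holder_bound_diff[OF G(2)] holder_bound_norm[OF P]) auto
        then show "cmod (exp (birkhoff_sum Astar n (w @- sconst z)) *
            ((g (rev w @- x) - g (rev w @- x')) * \<phi> (w @- sconst z)))
            \<le> B * (G * P) * \<theta> ^ n * exp (Re (birkhoff_sum A n (rev w @- x)))"
          by (simp add: norm_mult ac_simps)
      qed
      finally show ?thesis .
    qed
    then have "(\<lambda>n. inverse_seq a A W l \<psi> x z \<phi> n - inverse_seq a A W l \<psi> x' z \<phi> n) \<longlonglongrightarrow> 0"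
      by (rule tendsto_0_if_le_decay)
    moreover have "(\<lambda>n. inverse_seq a A W l \<psi> x z \<phi> n - inverse_seq a A W l \<psi> x' z \<phi> n) \<longlonglongrightarrow>
        inverse_functional \<theta> a A W l \<psi> x z \<phi> - inverse_functional \<theta> a A W l \<psi> x' z \<phi>"
      by (intro tendsto_diff inverse_functional_tendsto \<psi> \<phi>)
    ultimately show ?thesis using LIMSEQ_unique by fastforce
  qed
qed

text \<open>
  Inserting \<open>ruelle a Astar \<phi>\<close> in the dual form prolongs the word by one symbol \<open>j\<close> at its head. The
  result is \<open>l\<close> times the next term for \<open>\<phi>\<close>, except that \<open>\<psi> * exp (- W (sconst z, \<cdot>))\<close> is evaluated at
  \<open>rev w @- x\<close> instead of \<open>rev w @- j ## x\<close>; these points agree on \<open>n\<close> symbols.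
\<close>

lemma inverse_functional_eigendistribution:
  assumes \<psi>: "\<psi> \<in> eigenfunctions \<theta> a A l"
  shows "inverse_functional \<theta> a A W l \<psi> x z \<in> eigendistributions \<theta> a Astar l"
proof -
  let ?I = "inverse_seq a A W l \<psi> x z" and ?F = "inverse_functional \<theta> a A W l \<psi> x z"
  have "?F (ruelle a Astar \<phi>) = l * ?F \<phi>" if \<phi>: "\<phi> \<in> Holder \<theta>" for \<phi>
  proof -
    obtain P where P: "holder_bound \<theta> P \<phi>" using \<phi> Holder_iff_holder_bound by blast
    have P0: "0 \<le> P" by (rule holder_bound_nonneg[OF P])
    define g where "g = (\<lambda>x. \<psi> x * exp (- W (sconst z, x)))"
    obtain G where "0 \<le> G" "holder_bound \<theta> G (\<lambda>x. \<psi> x * exp (- W (sconst z, x)))"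
      by (rule normalized_eigenfunction_bound[OF \<psi>]) (rule that)
    note G = this[folded g_def]
    obtain B where B: "0 \<le> B" "\<And>n w x y. length w = n \<Longrightarrow>
      cmod (exp (birkhoff_sum Astar n (w @- y))) \<le> B * exp (Re (birkhoff_sum A n (rev w @- x)))"
      by (rule dual_weight_bound) (rule that)
    define b where "b = (\<lambda>n w. exp (birkhoff_sum Astar n (w @- sconst z)))"
    define C where "C = B * (G * P) / \<theta>"
    have C0: "0 \<le> C" using B(1) G(1) P0 theta_pos by (simp add: C_def)
    have "cmod (?I (ruelle a Astar \<phi>) n - l * ?I \<phi> (Suc n)) \<le> cmod l * C * decay (Suc n)" for n
    proof -
      have "?I (ruelle a Astar \<phi>) n
          = iter_integ a n (\<lambda>w. b n w * (g (rev w @- x) * ruelle a Astar \<phi> (w @- sconst z))) / l ^ n"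
        by (simp add: inverse_seq_eq_dual g_def b_def)
      also have "\<dots> = iter_integ a n (\<lambda>w. integ a (\<lambda>j. b (Suc n) (j # w) *
            (g (rev (tl (j # w)) @- x) * \<phi> ((j # w) @- sconst z)))) / l ^ n"
        by (simp add: ruelle_def b_def birkhoff_sum_Cons exp_add ac_simps flip: integ_cmult)
      also have "\<dots> = iter_integ a (Suc n) (\<lambda>w. b (Suc n) w * (g (rev (tl w) @- x) * \<phi> (w @- sconst z))) / l ^ n"
        by (subst iter_integ_Suc_Cons) (rule refl)
      also have "\<dots> = l * (iter_integ a (Suc n) (\<lambda>w. b (Suc n) w *
          (g (rev (tl w) @- x) * \<phi> (w @- sconst z))) / l ^ Suc n)"
        using l_nonzero by simp
      finally have I: "?I (ruelle a Astar \<phi>) n = l * (iter_integ a (Suc n) (\<lambda>w. b (Suc n) w *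
          (g (rev (tl w) @- x) * \<phi> (w @- sconst z))) / l ^ Suc n)" .
      have I': "?I \<phi> (Suc n) = iter_integ a (Suc n) (\<lambda>w. b (Suc n) w *
          (g (rev w @- x) * \<phi> (w @- sconst z))) / l ^ Suc n"
        by (simp only: inverse_seq_eq_dual g_def b_def)
      have "?I (ruelle a Astar \<phi>) n - l * ?I \<phi> (Suc n) = l * (iter_integ a (Suc n) (\<lambda>w. b (Suc n) w *
          ((g (rev (tl w) @- x) - g (rev w @- x)) * \<phi> (w @- sconst z))) / l ^ Suc n)"
        unfolding I I'
        by (simp only: left_diff_distrib right_diff_distrib iter_integ_diff diff_divide_distrib)
      moreover have "cmod (iter_integ a (Suc n) (\<lambda>w. b (Suc n) w *
          ((g (rev (tl w) @- x) - g (rev w @- x)) * \<phi> (w @- sconst z))) / l ^ Suc n) \<le> C * decay (Suc n)"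
      proof (rule integral_le_decay[OF C0])
        fix w :: "'m list" assume w: "length w = Suc n"
        then obtain j v where jv: "w = j # v" "length v = n" by (auto simp: length_Suc_conv)
        have "stake n (rev (tl w) @- x) = stake n (rev w @- x)" using jv by (simp add: stake_shift)
        then have "cmod (b (Suc n) w) * (cmod (g (rev (tl w) @- x) - g (rev w @- x)) * cmod (\<phi> (w @- sconst z)))
            \<le> (B * exp (Re (birkhoff_sum A (Suc n) (rev w @- x)))) * ((G * \<theta> ^ n) * P)"
          unfolding b_def using B(1) G(1) theta_pow[of n]
          by (intro mult_mono B(2) w holder_bound_diff[OF G(2)] holder_bound_norm[OF P]) auto
        also have "\<dots> = C * \<theta> ^ Suc n * exp (Re (birkhoff_sum A (Suc n) (rev w @- x)))"
          using theta_pos by (simp add: C_def)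
        finally show "cmod (b (Suc n) w * ((g (rev (tl w) @- x) - g (rev w @- x)) * \<phi> (w @- sconst z)))
            \<le> C * \<theta> ^ Suc n * exp (Re (birkhoff_sum A (Suc n) (rev w @- x)))"
          by (simp only: norm_mult)
      qed
      ultimately show ?thesis
        by (simp only: norm_mult mult.assoc mult_left_mono[OF _ norm_ge_zero])
    qed
    moreover have "(\<lambda>n. cmod l * C * decay (Suc n)) \<longlonglongrightarrow> 0"
      using tendsto_mult_left[OF LIMSEQ_Suc[OF summable_LIMSEQ_zero[OF summable_decay]], of "cmod l * C"] by simp
    ultimately have "(\<lambda>n. ?I (ruelle a Astar \<phi>) n - l * ?I \<phi> (Suc n)) \<longlonglongrightarrow> 0"
      by (rule Lim_null_comparison[OF always_eventually[OF allI]])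
    moreover have "(\<lambda>n. ?I (ruelle a Astar \<phi>) n - l * ?I \<phi> (Suc n)) \<longlonglongrightarrow> ?F (ruelle a Astar \<phi>) - l * ?F \<phi>"
      by (intro tendsto_diff tendsto_mult_left LIMSEQ_Suc inverse_functional_tendsto \<psi> \<phi>
          Holder_ruelle Astar_Holder)
    ultimately show ?thesis using LIMSEQ_unique by fastforce
  qed
  then show ?thesis using inverse_functional_in_dual[OF \<psi>] by (simp add: eigendistributions_def)
qed

lemma eigenfunction_funpow:
  assumes "\<psi> \<in> eigenfunctions \<theta> a A l"
  shows "(ruelle a A ^^ n) \<psi> x = l ^ n * \<psi> x"
proof (induction n arbitrary: x)
  case (Suc n)
  have "(ruelle a A ^^ n) \<psi> = (\<lambda>x. l ^ n * \<psi> x)" by (rule ext) (rule Suc)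
  then have "(ruelle a A ^^ Suc n) \<psi> x = ruelle a A (\<lambda>x. l ^ n * \<psi> x) x" by simp
  also have "\<dots> = l ^ n * ruelle a A \<psi> x"
    by (simp add: ruelle_def mult.left_commute[of _ "l ^ n"] integ_cmult)
  finally show ?case using assms by (simp add: eigenfunctions_def)
qed simp

text \<open>
  To evaluate the image at \<open>u\<close>, the base point may be moved to \<open>u\<close>. Then the factor \<open>exp (- W)\<close> in the
  formula cancels the test function \<open>exp (W (\<cdot>, u))\<close>, and every term of the sequence is
  \<open>(ruelle a A ^^ n) \<psi> u / l ^ n = \<psi> u\<close>.
\<close>

lemma kernel_map_inverse_functional:
  assumes \<psi>: "\<psi> \<in> eigenfunctions \<theta> a A l"
  shows "kernel_map W (inverse_functional \<theta> a A W l \<psi> x z) = \<psi>"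
proof
  fix u
  let ?e = "\<lambda>y. exp (W (y, u))"
  have "inverse_seq a A W l \<psi> u z ?e n = \<psi> u" for n
  proof -
    have "inverse_seq a A W l \<psi> u z ?e n
        = iter_integ a n (\<lambda>w. exp (birkhoff_sum A n (rev w @- u)) * \<psi> (rev w @- u)) / l ^ n"
      by (simp add: inverse_seq_eq flip: exp_add)
    also have "\<dots> = (ruelle a A ^^ n) \<psi> u / l ^ n"
      unfolding ruelle_funpow
      by (subst iter_integ_rev[of a n "\<lambda>w. exp (birkhoff_sum A n (w @- u)) * \<psi> (w @- u)"]) simp
    finally show ?thesis using l_nonzero by (simp add: eigenfunction_funpow[OF \<psi>])
  qed
  then have "inverse_seq a A W l \<psi> u z ?e = (\<lambda>_. \<psi> u)" by (rule ext)
  then have "inverse_seq a A W l \<psi> u z ?e \<longlonglongrightarrow> \<psi> u" by simp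
  then have "inverse_functional \<theta> a A W l \<psi> u z ?e = \<psi> u"
    by (rule LIMSEQ_unique[OF inverse_functional_tendsto[OF \<psi> exp_kernel_Holder]])
  then show "kernel_map W (inverse_functional \<theta> a A W l \<psi> x z) u = \<psi> u"
    unfolding kernel_map_def inverse_functional_base_point[OF \<psi>, of x z u] .
qed

lemma kernel_map_iso:
  "linear_iso_on_funs (eigendistributions \<theta> a Astar l) (eigenfunctions \<theta> a A l) (kernel_map W)"
proof -
  have "kernel_map W ` eigendistributions \<theta> a Astar l = eigenfunctions \<theta> a A l"
  proof
    show "kernel_map W ` eigendistributions \<theta> a Astar l \<subseteq> eigenfunctions \<theta> a A l"
      using kernel_map_eigenfunction by blast
    show "eigenfunctions \<theta> a A l \<subseteq> kernel_map W ` eigendistributions \<theta> a Astar l"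
      using kernel_map_inverse_functional inverse_functional_eigendistribution by (metis image_eqI subsetI)
  qed
  then show ?thesis
    using kernel_map_inj_on
    by (simp add: linear_iso_on_funs_def bij_betw_def linear_on_funs_def kernel_map_def fun_eq_iff)
qed

end

theorem theorem1:
  fixes \<theta> :: real and a :: "'m::finite \<Rightarrow> real"
    and A Astar :: "'m stream \<Rightarrow> complex" and W :: "'m stream \<times> 'm stream \<Rightarrow> complex"
    and l :: complex
  assumes "0 < \<theta>" and "\<theta> < 1"
    and "\<And>j. a j \<ge> 0" and "(\<Sum>j\<in>UNIV. a j) = 1"
    and "A \<in> Holder \<theta>" and "Astar \<in> Holder \<theta>" and "W \<in> Holder_X \<theta>"
    and "involution_kernel A Astar W"
    and "cmod l > rho a A * \<theta>"
  shows "convergent (rho_seq a A) \<and>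
    bounded_linear_on_funs (Holder_dual \<theta>) (dual_norm \<theta>) Cont sup_norm (kernel_map W) \<and>
    linear_iso_on_funs (eigendistributions \<theta> a Astar l) (eigenfunctions \<theta> a A l) (kernel_map W) \<and>
    (\<forall>\<psi>\<in>eigenfunctions \<theta> a A l. \<forall>x' z.
       (\<forall>\<phi>\<in>Holder \<theta>. convergent (inverse_seq a A W l \<psi> x' z \<phi>)) \<and>
       inverse_functional \<theta> a A W l \<psi> x' z \<in> Holder_dual \<theta> \<and>
       (\<forall>x''. inverse_functional \<theta> a A W l \<psi> x'' z = inverse_functional \<theta> a A W l \<psi> x' z) \<and>
       inverse_functional \<theta> a A W l \<psi> x' z \<in> eigendistributions \<theta> a Astar l \<and>
       kernel_map W (inverse_functional \<theta> a A W l \<psi> x' z) = \<psi>)"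
proof -
  interpret involution_eigenvalue \<theta> a A Astar W l
    by unfold_locales (use assms in auto)
  show ?thesis
    by (intro conjI ballI allI rho_seq_convergent kernel_map_bounded kernel_map_iso
        inverse_seq_convergent inverse_functional_in_dual inverse_functional_base_point
        inverse_functional_eigendistribution kernel_map_inverse_functional)
qed

end
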